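(* Let $K$ be an algebraically closed field of characteristic $0$. Let $p,q\geq 1$ be integers with $\frac{1}{5}\leq\frac{p}{q}\leq 5$, let $n=p+q$, let $A=\mathrm{diag}(I_p,0_q)\in M_n(K)$, and let $$\rho=\left\lfloor (11p^2+11q^2+2pq)/16\right\rfloor .$$ Then the algebraic variety $\{X\in M_n(K)\;|\;XA-AX=X^2-X^3\}$ has dimension $\rho$ or $\rho-1$.
   Context: $I_p$ is the $p\times p$ identity matrix, $0_q$ the $q\times q$ zero matrix, and $M_n(K)$ is identified with affine space $K^{n^2}$. *)

theory Defs
  imports
    "HOL-Library.Extended_Nat"
    "HOL-Computational_Algebra.Computational_Algebra"
    "Jordan_Normal_Form.Matrix"
begin

text \<open>
  Affine space of dimension \<open>n\<^sup>2\<close> is \<open>carrier_mat n n\<close>, with the \<open>n\<^sup>2\<close> matrix entries as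
  coordinates. The functions below are exactly those given by polynomials in these coordinates;
  only their restriction to \<open>carrier_mat n n\<close> is relevant.
\<close>

inductive poly_fun :: "nat \<Rightarrow> ('a :: field mat \<Rightarrow> 'a) \<Rightarrow> bool" for n :: nat where
  const: "poly_fun n (\<lambda>X. c)"
| coord: "i < n \<Longrightarrow> j < n \<Longrightarrow> poly_fun n (\<lambda>X. X $$ (i, j))"
| add: "poly_fun n f \<Longrightarrow> poly_fun n g \<Longrightarrow> poly_fun n (\<lambda>X. f X + g X)"
| mult: "poly_fun n f \<Longrightarrow> poly_fun n g \<Longrightarrow> poly_fun n (\<lambda>X. f X * g X)"

definition zariski_closed :: "nat \<Rightarrow> 'a :: field mat set \<Rightarrow> bool" where
  "zariski_closed n Z \<longleftrightarrow>
     (\<exists>F. (\<forall>f\<in>F. poly_fun n f) \<and> Z = {X \<in> carrier_mat n n. \<forall>f\<in>F. f X = 0})"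

definition irreducible_closed :: "nat \<Rightarrow> 'a :: field mat set \<Rightarrow> bool" where
  "irreducible_closed n Z \<longleftrightarrow> zariski_closed n Z \<and> Z \<noteq> {} \<and>
     (\<forall>Z1 Z2. zariski_closed n Z1 \<and> zariski_closed n Z2 \<and> Z = Z1 \<union> Z2 \<longrightarrow> Z = Z1 \<or> Z = Z2)"

text \<open>
  The dimension of an algebraic set \<open>V\<close> is its Krull dimension as a topological space. Since
  \<open>V\<close> is closed, its relatively closed subsets are the closed sets contained in it. The
  supremum over no chains at all, i.e. the dimension of the empty set, is \<open>0\<close> in \<^typ>\<open>enat\<close>.
\<close>

definition variety_dim :: "nat \<Rightarrow> 'a :: field mat set \<Rightarrow> enat" where
  "variety_dim n V = Sup {enat d | d. \<exists>Z :: nat \<Rightarrow> 'a mat set.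
     (\<forall>i\<le>d. irreducible_closed n (Z i) \<and> Z i \<subseteq> V) \<and> (\<forall>i<d. Z i \<subset> Z (Suc i))}"

lemma poly_fun_uminus: "poly_fun n f \<Longrightarrow> poly_fun n (\<lambda>X. - f X)"
  using poly_fun.mult[OF poly_fun.const[of n "-1"], of f] by simp

lemma poly_fun_diff:
  "poly_fun n f \<Longrightarrow> poly_fun n g \<Longrightarrow> poly_fun n (\<lambda>X. f X - g X)"
  using poly_fun.add[OF _ poly_fun_uminus, of n f g] by simp

lemma poly_fun_sum:
  "(\<And>k. k \<in> I \<Longrightarrow> poly_fun n (f k)) \<Longrightarrow> poly_fun n (\<lambda>X. \<Sum>k\<in>I. f k X)"
  by (induction I rule: infinite_finite_induct) (auto intro: poly_fun.intros)

lemma zariski_closed_commutator_variety: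
  fixes A :: "'a :: field mat"
  assumes A: "A \<in> carrier_mat n n"
  shows "zariski_closed n {X \<in> carrier_mat n n. X * A - A * X = X ^\<^sub>m 2 - X ^\<^sub>m 3}"
proof -
  define s where "s = (\<lambda>f g (i :: nat) (j :: nat) (X :: 'a mat). \<Sum>k<n. f i k X * g k j X :: 'a)"
  define x where "x = (\<lambda>i j (X :: 'a mat). X $$ (i, j))"
  define a where "a = (\<lambda>(i :: nat) (j :: nat) (X :: 'a mat). A $$ (i, j))"
  define e where "e = (\<lambda>i j X. (s x a i j X - s a x i j X) - (s x x i j X - s (s x x) x i j X))"
  have s: "poly_fun n (s f g i j)"
    if "\<And>i j. i < n \<Longrightarrow> j < n \<Longrightarrow> poly_fun n (f i j)"
       "\<And>i j. i < n \<Longrightarrow> j < n \<Longrightarrow> poly_fun n (g i j)" "i < n" "j < n" for f g i j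
    unfolding s_def using that by (intro poly_fun_sum poly_fun.mult) auto
  have x: "poly_fun n (x i j)" if "i < n" "j < n" for i j
    unfolding x_def using that by (rule poly_fun.coord)
  have a: "poly_fun n (a i j)" for i j
    unfolding a_def by (rule poly_fun.const)
  have e: "poly_fun n (e i j)" if "i < n" "j < n" for i j
    unfolding e_def using that by (intro poly_fun_diff s x a)
  have eq: "X * A - A * X = X ^\<^sub>m 2 - X ^\<^sub>m 3 \<longleftrightarrow> (\<forall>i<n. \<forall>j<n. e i j X = 0)"
    if X: "X \<in> carrier_mat n n" for X
  proof -
    have prod: "(B * C) $$ (i, j) = (\<Sum>k<n. B $$ (i, k) * C $$ (k, j))"
      if "B \<in> carrier_mat n n" "C \<in> carrier_mat n n" "i < n" "j < n" for B C :: "'a mat" and i j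
      using that by (auto simp: scalar_prod_def lessThan_atLeast0)
    have "X ^\<^sub>m 2 = X * X" "X ^\<^sub>m 3 = X * X * X"
      using X by (simp_all add: numeral_eq_Suc)
    moreover have "(X * A - A * X - (X * X - X * X * X)) $$ (i, j) = e i j X"
      if "i < n" "j < n" for i j
    proof -
      have XX: "X * X \<in> carrier_mat n n" using X by simp
      show ?thesis
        using that X A XX prod[OF X A] prod[OF A X] prod[OF X X] prod[OF XX X]
        by (simp add: e_def s_def x_def a_def del: index_mult_mat(1))
    qed
    moreover have "X * A - A * X = X * X - X * X * X \<longleftrightarrow>
        (\<forall>i<n. \<forall>j<n. (X * A - A * X - (X * X - X * X * X)) $$ (i, j) = 0)"
      using X A by (auto simp: mat_eq_iff simp del: index_mult_mat(1))
    ultimately show ?thesis by auto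
  qed
  show ?thesis
    unfolding zariski_closed_def
    by (rule exI[of _ "{e i j | i j. i < n \<and> j < n}"]) (use e eq in blast)
qed

end

theory Submission
  imports Defs
    "HOL-Library.FuncSet"
    "HOL-Library.Function_Algebras"
    "HOL-Combinatorics.Permutations"
begin

text \<open>
  Write \<open>X\<close> in blocks \<open>P, Q, R, S\<close> according to \<open>A\<close>. Then \<open>X A - A X\<close> has blocks \<open>0, -Q, R, 0\<close>, and it
  commutes with \<open>X\<close> because it equals \<open>X\<^sup>2 - X\<^sup>3\<close>. Comparing blocks gives \<open>Q R = 0\<close>, \<open>R Q = 0\<close>,
  \<open>P Q = Q S\<close> and \<open>R P = S R\<close>, and then the equation reduces to \<open>R = 0\<close>, \<open>P\<^sup>3 = P\<^sup>2\<close>, \<open>S\<^sup>3 = S\<^sup>2\<close>,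
  \<open>P Q = Q = Q S\<close>. For fixed ranks \<open>r, a\<close> of \<open>P, P\<^sup>2\<close> and \<open>s, b\<close> of \<open>S, S\<^sup>2\<close>, iterated rank
  factorizations parametrize the solutions by
  \<open>2 r (p - r) + 2 a (r - a) + 2 s (q - s) + 2 b (s - b) + a b\<close> free coordinates. Over the reals this
  quadratic form has maximum \<open>(11 p\<^sup>2 + 11 q\<^sup>2 + 2 p q) / 16\<close>, attained at \<open>a = (3 p + q) / 8\<close>,
  \<open>b = (3 q + p) / 8\<close>, \<open>r = (p + a) / 2\<close>, \<open>s = (q + b) / 2\<close>; the assumption on \<open>p / q\<close> says that
  \<open>a \<le> p\<close> and \<open>b \<le> q\<close>. Rounding loses less than \<open>2\<close>.

  Krull dimension is compared with the number of coordinates through algebraic independence. A chain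
  of length \<open>d\<close> yields \<open>d\<close> functions that are algebraically independent on its top element, while
  more than \<open>N\<close> polynomials in \<open>N\<close> variables are dependent, by counting monomials. Conversely, if the
  chart has injective differential at a point, then the closures of the images of a flag of coordinate
  subspaces form a strict chain.
\<close>

section \<open>Polynomial functions and algebraic independence\<close>

text \<open>Polynomials are encoded by the functions they induce on all of
  \<open>'i \<Rightarrow> 'a\<close>, so that substitution is plain composition. Over an infinite
  field the function determines the polynomial.\<close>

inductive polyf :: "'i set \<Rightarrow> (('i \<Rightarrow> 'a :: field) \<Rightarrow> 'a) \<Rightarrow> bool" for I :: "'i set" where
  const: "polyf I (\<lambda>x. c)"
| coord: "i \<in> I \<Longrightarrow> polyf I (\<lambda>x. x i)"
| add: "polyf I f \<Longrightarrow> polyf I g \<Longrightarrow> polyf I (\<lambda>x. f x + g x)"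
| mult: "polyf I f \<Longrightarrow> polyf I g \<Longrightarrow> polyf I (\<lambda>x. f x * g x)"

lemma polyf_diff: "polyf I f \<Longrightarrow> polyf I g \<Longrightarrow> polyf I (\<lambda>x. f x - g x)"
  using polyf.add[OF _ polyf.mult[OF polyf.const[of I "-1"]], of f g] by simp

lemma polyf_sum: "(\<And>k. k \<in> K \<Longrightarrow> polyf I (f k)) \<Longrightarrow> polyf I (\<lambda>x. \<Sum>k\<in>K. f k x)"
  by (induction K rule: infinite_finite_induct) (auto intro: polyf.intros)

lemma polyf_prod: "(\<And>k. k \<in> K \<Longrightarrow> polyf I (f k)) \<Longrightarrow> polyf I (\<lambda>x. \<Prod>k\<in>K. f k x)"
  by (induction K rule: infinite_finite_induct) (auto intro: polyf.intros)

lemma polyf_power: "polyf I f \<Longrightarrow> polyf I (\<lambda>x. f x ^ k)"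
  by (induction k) (auto intro: polyf.intros)

lemma polyf_mono: "polyf I f \<Longrightarrow> I \<subseteq> J \<Longrightarrow> polyf J f"
  by (induction rule: polyf.induct) (auto intro: polyf.intros)

lemma polyf_cong: "polyf I f \<Longrightarrow> (\<And>i. i \<in> I \<Longrightarrow> x i = y i) \<Longrightarrow> f x = f y"
  by (induction rule: polyf.induct) auto

lemma polyf_subst:
  "polyf I P \<Longrightarrow> (\<And>i. i \<in> I \<Longrightarrow> polyf J (F i)) \<Longrightarrow> polyf J (\<lambda>x. P (\<lambda>i. F i x))"
  by (induction rule: polyf.induct) (auto intro: polyf.intros)

lemma poly_fun_subst:
  "polyf I P \<Longrightarrow> (\<And>i. i \<in> I \<Longrightarrow> poly_fun n (f i)) \<Longrightarrow> poly_fun n (\<lambda>X. P (\<lambda>i. f i X))"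
  by (induction rule: polyf.induct) (auto intro: poly_fun.intros)

text \<open>Restricting to a curve with polynomial coordinates turns a question about
  \<open>P\<close> into one about a univariate \<open>poly\<close>.\<close>

lemma polyf_along_curve:
  "polyf I P \<Longrightarrow> (\<And>i. i \<in> I \<Longrightarrow> \<exists>h. \<forall>t. w t i = poly h t) \<Longrightarrow> \<exists>g. \<forall>t. P (w t) = poly g t"
proof (induction rule: polyf.induct)
  case (const c)
  show ?case by (rule exI[of _ "[:c:]"]) simp
next
  case (coord i)
  then show ?case by simp
next
  case (add f g)
  then obtain h k where "\<forall>t. f (w t) = poly h t" "\<forall>t. g (w t) = poly k t" by blast
  then show ?case by (intro exI[of _ "h + k"]) simp
next
  case (mult f g)
  then obtain h k where "\<forall>t. f (w t) = poly h t" "\<forall>t. g (w t) = poly k t" by blast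
  then show ?case by (intro exI[of _ "h * k"]) simp
qed

lemma poly_eq_0_if_almost_everywhere:
  fixes h :: "'a :: field_char_0 poly"
  assumes "finite S" "\<And>t. t \<notin> S \<Longrightarrow> poly h t = 0"
  shows "h = 0"
proof (rule ccontr)
  assume "h \<noteq> 0"
  then have "finite {t. poly h t = 0}" by (rule poly_roots_finite)
  then have "finite (S \<union> {t. poly h t = 0})" using assms(1) by simp
  moreover have "S \<union> {t. poly h t = 0} = UNIV" using assms(2) by auto
  ultimately show False using infinite_UNIV_char_0 by metis
qed

text \<open>On the line through \<open>x\<close> and \<open>y\<close> both functions become nonzero
  univariate polynomials, one seen at \<open>t = 0\<close>, the other at \<open>t = 1\<close>, so
  their product is nonzero. The witness stays in every linear subspace that contains
  \<open>x\<close> and \<open>y\<close>.\<close>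

lemma polyf_common_nonzero:
  fixes f g :: "('i \<Rightarrow> 'a :: field_char_0) \<Rightarrow> 'a"
  assumes f: "polyf I f" "f x \<noteq> 0" and g: "polyf I g" "g y \<noteq> 0"
  shows "\<exists>t. f (\<lambda>i. x i + t * (y i - x i)) \<noteq> 0 \<and> g (\<lambda>i. x i + t * (y i - x i)) \<noteq> 0"
proof -
  let ?w = "\<lambda>t i. x i + t * (y i - x i)"
  have w: "\<exists>h. \<forall>t. ?w t i = poly h t" for i
    by (rule exI[of _ "[:x i, y i - x i:]"]) simp
  obtain h k where h: "\<forall>t. f (?w t) = poly h t" and k: "\<forall>t. g (?w t) = poly k t"
    using polyf_along_curve[OF f(1), of ?w] polyf_along_curve[OF g(1), of ?w] w by blast
  have "poly h 0 \<noteq> 0" "poly k 1 \<noteq> 0" using h[rule_format, of 0] k[rule_format, of 1] f g by auto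
  then have "h * k \<noteq> 0" by auto
  then have "\<exists>t. poly (h * k) t \<noteq> 0" using poly_all_0_iff_0 by blast
  then show ?thesis using h k by auto
qed

lemma polyf_expand:
  assumes "polyf (insert v I) P"
  shows "\<exists>m c. (\<forall>k. polyf (I - {v}) (c k)) \<and> (\<forall>k>m. c k = (\<lambda>_. 0)) \<and>
           (\<forall>y. P y = (\<Sum>k\<le>m. c k y * y v ^ k))"
  using assms
proof (induction rule: polyf.induct)
  case (const c)
  show ?case
    by (rule exI[of _ 0], rule exI[of _ "\<lambda>k. if k = 0 then \<lambda>_. c else (\<lambda>_. 0)"])
      (auto intro: polyf.intros)
next
  case (coord i)
  show ?case
  proof (cases "i = v")
    case True
    then show ?thesis
      by (intro exI[of _ 1] exI[of _ "\<lambda>k. if k = 1 then \<lambda>_. 1 else (\<lambda>_. 0)"])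
        (auto intro: polyf.intros)
  next
    case False
    then show ?thesis using coord
      by (intro exI[of _ 0] exI[of _ "\<lambda>k. if k = 0 then \<lambda>y. y i else (\<lambda>_. 0)"])
        (auto intro: polyf.intros)
  qed
next
  case (add f g)
  obtain m c where c: "\<And>k. polyf (I - {v}) (c k)" "\<And>k. k > m \<Longrightarrow> c k = (\<lambda>_. 0)"
    "\<And>y. f y = (\<Sum>k\<le>m. c k y * y v ^ k)" using add.IH(1) by auto
  obtain l d where d: "\<And>k. polyf (I - {v}) (d k)" "\<And>k. k > l \<Longrightarrow> d k = (\<lambda>_. 0)"
    "\<And>y. g y = (\<Sum>k\<le>l. d k y * y v ^ k)" using add.IH(2) by auto
  have "f y = (\<Sum>k\<le>m+l. c k y * y v ^ k)" "g y = (\<Sum>k\<le>m+l. d k y * y v ^ k)" for y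
    unfolding c(3) d(3) by (rule sum.mono_neutral_left; use c(2) d(2) in auto)+
  then show ?case
    using c(1,2) d(1,2)
    by (intro exI[of _ "m + l"] exI[of _ "\<lambda>k y. c k y + d k y"])
      (auto intro: polyf.intros simp: sum.distrib algebra_simps)
next
  case (mult f g)
  obtain m c where c: "\<And>k. polyf (I - {v}) (c k)" "\<And>k. k > m \<Longrightarrow> c k = (\<lambda>_. 0)"
    "\<And>y. f y = (\<Sum>k\<le>m. c k y * y v ^ k)" using mult.IH(1) by auto
  obtain l d where d: "\<And>k. polyf (I - {v}) (d k)" "\<And>k. k > l \<Longrightarrow> d k = (\<lambda>_. 0)"
    "\<And>y. g y = (\<Sum>k\<le>l. d k y * y v ^ k)" using mult.IH(2) by auto
  define e where "e k y = (\<Sum>i\<le>k. c i y * d (k - i) y)" for k y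
  have "e k = (\<lambda>_. 0)" if "k > m + l" for k
  proof
    fix y
    have "c i y * d (k - i) y = 0" for i
      using c(2)[of i] d(2)[of "k - i"] that by (cases "i > m") auto
    then show "e k y = 0" unfolding e_def by (intro sum.neutral ballI)
  qed
  moreover have "polyf (I - {v}) (e k)" for k
    unfolding e_def by (intro polyf_sum polyf.mult c d)
  moreover have "f y * g y = (\<Sum>k\<le>m+l. e k y * y v ^ k)" for y
    unfolding c(3) d(3) e_def
    by (rule polynomial_product) (use c(2) d(2) in auto)
  ultimately show ?case by (intro exI[of _ "m + l"] exI[of _ e]) auto
qed

text \<open>The largest power of \<open>y v\<close> is split off: \<open>k\<close> is the first
  index whose coefficient in \<open>polyf_expand\<close> is not the zero function, and
  \<open>Q\<close> restricted to \<open>y v = 0\<close> is that coefficient.\<close>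

lemma polyf_factor:
  assumes P: "polyf (insert v I) P" and "P y0 \<noteq> 0"
  shows "\<exists>k Q. polyf (insert v I) Q \<and> (\<forall>y. P y = y v ^ k * Q y) \<and> (\<exists>y. y v = 0 \<and> Q y \<noteq> 0)"
proof -
  obtain m c where c: "\<And>k. polyf (I - {v}) (c k)" "\<And>k. k > m \<Longrightarrow> c k = (\<lambda>_. 0)"
    "\<And>y. P y = (\<Sum>k\<le>m. c k y * y v ^ k)" using polyf_expand[OF P] by auto
  define k where "k = (LEAST k. \<exists>y. c k y \<noteq> 0)"
  have "\<exists>k. \<exists>y. c k y \<noteq> 0"
  proof (rule ccontr)
    assume "\<not> ?thesis"
    then show False using assms(2) unfolding c(3) by simp
  qed
  then have "\<exists>y. c k y \<noteq> 0" unfolding k_def by (rule LeastI_ex)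
  then obtain y where y: "c k y \<noteq> 0" by blast
  have z: "c j = (\<lambda>_. 0)" if "j < k" for j
    using not_less_Least[of j "\<lambda>k. \<exists>y. c k y \<noteq> 0"] that unfolding k_def by auto
  define Q where "Q y = (\<Sum>j\<le>m. c (j + k) y * y v ^ j)" for y
  have "polyf (insert v I) (c k)" for k using c(1) polyf_mono[of "I - {v}"] by blast
  then have 1: "polyf (insert v I) Q"
    unfolding Q_def by (intro polyf_sum polyf.mult polyf_power polyf.coord) auto
  have 2: "P y = y v ^ k * Q y" for y
  proof -
    have "P y = (\<Sum>j\<in>{..m+k}. c j y * y v ^ j)"
      unfolding c(3) by (rule sum.mono_neutral_left; use c(2) in auto)
    also have "\<dots> = (\<Sum>j\<in>{k..m+k}. c j y * y v ^ j)"
      by (rule sum.mono_neutral_right; use z in auto)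
    also have "\<dots> = (\<Sum>j\<in>{0..m}. c (j+k) y * y v ^ (j+k))"
      using sum.shift_bounds_cl_nat_ivl[of "\<lambda>j. c j y * y v ^ j" 0 k m] by simp
    also have "\<dots> = y v ^ k * Q y"
      unfolding Q_def sum_distrib_left atLeast0AtMost by (simp add: power_add mult_ac)
    finally show ?thesis .
  qed
  have "Q (y(v := 0)) = c k (y(v := 0))"
    unfolding Q_def by (subst sum.remove[of _ 0]) auto
  also have "\<dots> = c k y" by (rule polyf_cong[OF c(1)]) auto
  finally show ?thesis
    using 1 2 y by (intro exI[of _ k] exI[of _ Q]) (auto intro!: exI[of _ "y(v := 0)"])
qed

definition indep_on :: "'b set \<Rightarrow> ('i \<Rightarrow> 'b \<Rightarrow> 'a :: field) \<Rightarrow> 'i set \<Rightarrow> bool" where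
  "indep_on S f I \<longleftrightarrow>
     (\<forall>P. polyf I P \<longrightarrow> (\<forall>X\<in>S. P (\<lambda>i. f i X) = 0) \<longrightarrow> (\<forall>y. P y = 0))"

text \<open>Fixing all variables but one leaves a univariate polynomial that vanishes identically;
  its coefficients are sums of the same form in fewer variables.\<close>

lemma polyf_monomials_independent:
  fixes u :: "('i \<Rightarrow> nat) \<Rightarrow> 'a :: field_char_0"
  assumes "finite I" "\<And>y. (\<Sum>\<alpha>\<in>I \<rightarrow>\<^sub>E {..m}. u \<alpha> * (\<Prod>i\<in>I. y i ^ \<alpha> i)) = 0"
    and "\<alpha> \<in> I \<rightarrow>\<^sub>E {..m}"
  shows "u \<alpha> = 0"
  using assms
proof (induction I arbitrary: u \<alpha> rule: finite_induct)
  case empty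
  then show ?case by simp
next
  case (insert v I)
  define c where "c y k = (\<Sum>\<beta>\<in>I \<rightarrow>\<^sub>E {..m}. u (\<beta>(v := k)) * (\<Prod>i\<in>I. y i ^ \<beta> i))"
    for y :: "'i \<Rightarrow> 'a" and k
  have e: "(\<Sum>k\<le>m. c y k * t ^ k) = 0" for y t
  proof -
    have inj: "inj_on (\<lambda>(k, \<beta>). \<beta>(v := k)) ({..m} \<times> (I \<rightarrow>\<^sub>E {..m}))"
      using insert.hyps by (intro inj_combinator)
    have "0 = (\<Sum>\<alpha>\<in>insert v I \<rightarrow>\<^sub>E {..m}. u \<alpha> * (\<Prod>i\<in>insert v I. (y(v := t)) i ^ \<alpha> i))"
      using insert.prems(1) by simp
    also have "\<dots> = (\<Sum>(k, \<beta>)\<in>{..m} \<times> (I \<rightarrow>\<^sub>E {..m}).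
        u (\<beta>(v := k)) * (\<Prod>i\<in>insert v I. (y(v := t)) i ^ (\<beta>(v := k)) i))"
      unfolding PiE_insert_eq by (subst sum.reindex[OF inj]) (simp add: case_prod_beta)
    also have "\<dots> = (\<Sum>(k, \<beta>)\<in>{..m} \<times> (I \<rightarrow>\<^sub>E {..m}).
        u (\<beta>(v := k)) * (\<Prod>i\<in>I. y i ^ \<beta> i) * t ^ k)"
    proof (intro sum.cong refl, clarify)
      fix k \<beta>
      have "(\<Prod>i\<in>I. (y(v := t)) i ^ (\<beta>(v := k)) i) = (\<Prod>i\<in>I. y i ^ \<beta> i)"
        using insert.hyps by (intro prod.cong) auto
      then show "u (\<beta>(v := k)) * (\<Prod>i\<in>insert v I. (y(v := t)) i ^ (\<beta>(v := k)) i) =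
          u (\<beta>(v := k)) * (\<Prod>i\<in>I. y i ^ \<beta> i) * t ^ k"
        using insert.hyps by (simp add: mult_ac)
    qed
    also have "\<dots> = (\<Sum>k\<le>m. c y k * t ^ k)"
      unfolding c_def sum_distrib_right by (simp add: sum.cartesian_product)
    finally show ?thesis by simp
  qed
  have c0: "c y k = 0" if "k \<le> m" for y k
  proof -
    have "poly (\<Sum>k\<le>m. monom (c y k) k) t = 0" for t
      using e[of y t] by (simp add: poly_sum poly_monom)
    then have "(\<Sum>k\<le>m. monom (c y k) k) = 0" using poly_all_0_iff_0 by blast
    then have "coeff (\<Sum>k\<le>m. monom (c y k) k) k = 0" by simp
    then show ?thesis using that by (simp add: coeff_sum)
  qed
  obtain k \<beta> where \<alpha>: "\<alpha> = \<beta>(v := k)" "k \<le> m" "\<beta> \<in> I \<rightarrow>\<^sub>E {..m}"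
    using insert.prems(2) unfolding PiE_insert_eq by auto
  show ?case
    unfolding \<alpha>(1) by (rule insert.IH[of "\<lambda>\<beta>. u (\<beta>(v := k))"]) (use c0[OF \<alpha>(2)] \<alpha> c_def in auto)
qed

lemma sum_fun_apply: "(\<Sum>a\<in>A. f a) x = (\<Sum>a\<in>A. f a x)"
  by (induction A rule: infinite_finite_induct) auto

interpretation fun_space: vector_space "\<lambda>(c :: 'a :: field) (f :: 'b \<Rightarrow> 'a) x. c * f x"
  by unfold_locales (auto simp: fun_eq_iff algebra_simps)

text \<open>Steinitz exchange bounds independent sets inside a span. That bound concerns sets, so a
  family with a repeated member is treated separately, by the relation
  \<open>F a - F b = 0\<close>.\<close>

lemma family_dependent_if_many:
  fixes F :: "'k \<Rightarrow> 'b \<Rightarrow> 'a :: field"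
  assumes "finite A" "finite T" "card T < card A" "\<And>a. a \<in> A \<Longrightarrow> F a \<in> fun_space.span T"
  shows "\<exists>u. (\<exists>a\<in>A. u a \<noteq> 0) \<and> (\<forall>x. (\<Sum>a\<in>A. u a * F a x) = 0)"
proof (cases "inj_on F A")
  case True
  have "\<not> fun_space.independent (F ` A)"
  proof
    assume "fun_space.independent (F ` A)"
    then have "card (F ` A) \<le> card T"
      using fun_space.independent_span_bound[of T "F ` A"] assms by blast
    then show False using card_image[OF True] assms by simp
  qed
  then obtain u where u: "\<exists>v\<in>F ` A. u v \<noteq> 0" "(\<Sum>v\<in>F ` A. (\<lambda>x. u v * v x)) = 0"
    using fun_space.dependent_finite[of "F ` A"] assms(1) by auto
  have "(\<Sum>v\<in>F ` A. u v * v x) = 0" for x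
    using fun_cong[OF u(2), of x] by (simp add: sum_fun_apply)
  then have "(\<Sum>a\<in>A. u (F a) * F a x) = 0" for x
    by (simp add: sum.reindex[OF True])
  then show ?thesis using u(1) by (intro exI[of _ "\<lambda>a. u (F a)"]) auto
next
  case False
  then obtain a b where ab: "a \<in> A" "b \<in> A" "a \<noteq> b" "F a = F b" unfolding inj_on_def by blast
  let ?u = "\<lambda>k. if k = a then 1 else if k = b then -1 else 0"
  have "(\<Sum>k\<in>A. ?u k * F k x) = (\<Sum>k\<in>{a, b}. ?u k * F k x)" for x
    by (rule sum.mono_neutral_right) (use assms(1) ab in auto)
  then show ?thesis using ab by (intro exI[of _ ?u]) auto
qed

section \<open>Bounds for the Krull dimension\<close>

text \<open>Each exponent is bounded separately instead of the total degree: the count is then at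
  most a power of \<open>e + 1\<close>, and bounds add under multiplication.\<close>

definition monomials :: "'i set \<Rightarrow> nat \<Rightarrow> (('i \<Rightarrow> 'a :: field) \<Rightarrow> 'a) set" where
  "monomials I e = (\<lambda>\<alpha> x. \<Prod>i\<in>I. x i ^ \<alpha> i) ` (I \<rightarrow>\<^sub>E {..e})"

lemma finite_monomials: "finite I \<Longrightarrow> finite (monomials I e)"
  unfolding monomials_def by (intro finite_imageI finite_PiE) auto

lemma card_monomials_le: "finite I \<Longrightarrow> card (monomials I e) \<le> (e + 1) ^ card I"
  unfolding monomials_def
  by (rule order_trans[OF card_image_le]) (auto intro: finite_PiE simp: card_PiE)

lemma monomials_mono: "a \<le> b \<Longrightarrow> monomials I a \<subseteq> monomials I b"
  unfolding monomials_def by (intro image_mono PiE_mono) auto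

lemma span_monomials_mono:
  "f \<in> fun_space.span (monomials I a) \<Longrightarrow> a \<le> b \<Longrightarrow> f \<in> fun_space.span (monomials I b)"
  using fun_space.span_mono[OF monomials_mono] by blast

lemma monomial_in_monomials:
  assumes "\<And>i. i \<in> I \<Longrightarrow> \<alpha> i \<le> e"
  shows "(\<lambda>x. \<Prod>i\<in>I. x i ^ \<alpha> i) \<in> monomials I e"
proof -
  have "(\<lambda>x :: 'a \<Rightarrow> 'b. \<Prod>i\<in>I. x i ^ \<alpha> i) = (\<lambda>x. \<Prod>i\<in>I. x i ^ restrict \<alpha> I i)"
    by (intro ext prod.cong) auto
  then show ?thesis unfolding monomials_def by (intro image_eqI[of _ _ "restrict \<alpha> I"]) (use assms in auto)
qed

lemma monomials_mult:
  assumes "f \<in> monomials I a" "g \<in> monomials I b"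
  shows "(\<lambda>x. f x * g x) \<in> monomials I (a + b)"
proof -
  obtain \<alpha> \<beta> where \<alpha>: "\<alpha> \<in> I \<rightarrow>\<^sub>E {..a}" "f = (\<lambda>x. \<Prod>i\<in>I. x i ^ \<alpha> i)"
    and \<beta>: "\<beta> \<in> I \<rightarrow>\<^sub>E {..b}" "g = (\<lambda>x. \<Prod>i\<in>I. x i ^ \<beta> i)"
    using assms unfolding monomials_def by auto
  have "(\<lambda>x. f x * g x) = (\<lambda>x. \<Prod>i\<in>I. x i ^ (\<alpha> i + \<beta> i))"
    unfolding \<alpha>(2) \<beta>(2) by (simp add: power_add prod.distrib)
  also have "\<dots> \<in> monomials I (a + b)"
    by (rule monomial_in_monomials) (use \<alpha>(1) \<beta>(1) in \<open>fastforce intro: add_mono\<close>)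
  finally show ?thesis .
qed

lemma span_mult:
  assumes f: "f \<in> fun_space.span A" and g: "g \<in> fun_space.span B"
    and "\<And>a b. a \<in> A \<Longrightarrow> b \<in> B \<Longrightarrow> (\<lambda>x. a x * b x) \<in> fun_space.span C"
  shows "(\<lambda>x. f x * g x) \<in> fun_space.span C"
proof -
  have sub: "fun_space.subspace {h. (\<lambda>x. h x * k x) \<in> fun_space.span C}" for k
    unfolding fun_space.subspace_def
    using fun_space.span_zero[of C] fun_space.span_add[of _ C] fun_space.span_scale[of _ C]
    by (auto simp: distrib_right plus_fun_def zero_fun_def mult.assoc)
  have sub': "fun_space.subspace {h. (\<lambda>x. k x * h x) \<in> fun_space.span C}" for k
    using sub[of k] by (simp add: mult.commute)
  have "(\<lambda>x. f x * b x) \<in> fun_space.span C" if "b \<in> B" for b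
    using fun_space.span_induct[OF f sub[of b]] assms(3) that by auto
  then show ?thesis
    using fun_space.span_induct[OF g sub'[of f]] by auto
qed

lemma span_monomials_mult:
  assumes "f \<in> fun_space.span (monomials I a)" "g \<in> fun_space.span (monomials I b)"
  shows "(\<lambda>x. f x * g x) \<in> fun_space.span (monomials I (a + b))"
  by (rule span_mult[OF assms]) (intro fun_space.span_base monomials_mult)

lemma one_in_span_monomials: "(\<lambda>x. 1) \<in> fun_space.span (monomials I e)"
  using monomial_in_monomials[of I "\<lambda>_. 0" e] by (auto intro: fun_space.span_base)

lemma span_monomials_power:
  "f \<in> fun_space.span (monomials I e) \<Longrightarrow> (\<lambda>x. f x ^ k) \<in> fun_space.span (monomials I (k * e))"
proof (induction k)
  case 0
  then show ?case by (simp add: one_in_span_monomials)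
next
  case (Suc k)
  then show ?case using span_monomials_mult[of f I e "\<lambda>x. f x ^ k" "k * e"] by simp
qed

lemma span_monomials_prod:
  "finite J \<Longrightarrow> (\<And>j. j \<in> J \<Longrightarrow> F j \<in> fun_space.span (monomials I e)) \<Longrightarrow>
    (\<lambda>x. \<Prod>j\<in>J. F j x) \<in> fun_space.span (monomials I (card J * e))"
proof (induction J rule: finite_induct)
  case empty
  then show ?case by (simp add: one_in_span_monomials)
next
  case (insert j J)
  then show ?case
    using span_monomials_mult[of "F j" I e "\<lambda>x. \<Prod>j\<in>J. F j x" "card J * e"] by simp
qed

lemma polyf_in_span_monomials:
  assumes "finite I" "polyf I f"
  shows "\<exists>e. f \<in> fun_space.span (monomials I e)"
  using assms(2)
proof (induction rule: polyf.induct)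
  case (const c)
  then show ?case
    using fun_space.span_scale[OF one_in_span_monomials, of c] by (intro exI[of _ 0]) simp
next
  case (coord i)
  have "(\<lambda>x :: _ \<Rightarrow> 'b. \<Prod>j\<in>I. x j ^ (if j = i then 1 else 0)) = (\<lambda>x. x i)"
    using coord assms(1) by (simp add: if_distrib[of "(^) _"] prod.delta cong: if_cong)
  then show ?case
    using monomial_in_monomials[of I "\<lambda>j. if j = i then 1 else 0" 1, where ?'b = 'b]
    by (intro exI[of _ 1] fun_space.span_base) auto
next
  case (add f g)
  then obtain a b where ab: "f \<in> fun_space.span (monomials I a)"
    "g \<in> fun_space.span (monomials I b)" by blast
  have "f + g \<in> fun_space.span (monomials I (a + b))"
    by (intro fun_space.span_add span_monomials_mono[OF ab(1)] span_monomials_mono[OF ab(2)]) auto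
  then show ?case unfolding plus_fun_def by blast
next
  case (mult f g)
  then show ?case using span_monomials_mult by blast
qed

text \<open>There are \<open>(m + 1) ^ card J\<close> products of powers of the \<open>F j\<close>
  with exponents at most \<open>m\<close>, but they lie in a span whose dimension grows only like
  \<open>m ^ card I\<close>. For large \<open>m\<close> they are linearly dependent, and the
  coefficients form a relation.\<close>

lemma polyf_dependent:
  fixes F :: "'j \<Rightarrow> ('i \<Rightarrow> 'a :: field_char_0) \<Rightarrow> 'a"
  assumes I: "finite I" and J: "finite J" and "card I < card J"
    and F: "\<And>j. j \<in> J \<Longrightarrow> polyf I (F j)"
  shows "\<not> indep_on UNIV F J"
proof
  assume indep: "indep_on UNIV F J"
  obtain e where e: "\<And>j. j \<in> J \<Longrightarrow> F j \<in> fun_space.span (monomials I (e j))"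
    using polyf_in_span_monomials[OF I F] by metis
  define E where "E = sum e J"
  have E: "F j \<in> fun_space.span (monomials I E)" if "j \<in> J" for j
    by (rule span_monomials_mono[OF e[OF that]]) (use J that in \<open>auto simp: E_def intro: member_le_sum\<close>)
  \<comment> \<open>With this choice the spanning set has at most
    \<open>(m + 1) ^ card I * m\<close> elements, which is below
    \<open>(m + 1) ^ Suc (card I)\<close>.\<close>
  define m where "m = (card J * E + 1) ^ card I"
  let ?T = "monomials I (card J * (m * E)) :: (('i \<Rightarrow> 'a) \<Rightarrow> 'a) set"
  have span: "(\<lambda>x. \<Prod>j\<in>J. F j x ^ \<alpha> j) \<in> fun_space.span ?T" if "\<alpha> \<in> J \<rightarrow>\<^sub>E {..m}" for \<alpha>
  proof (rule span_monomials_prod[OF J])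
    fix j assume j: "j \<in> J"
    then have "\<alpha> j * E \<le> m * E" using that by (auto simp: PiE_def Pi_def)
    then show "(\<lambda>x. F j x ^ \<alpha> j) \<in> fun_space.span (monomials I (m * E))"
      using span_monomials_power[OF E[OF j]] span_monomials_mono by blast
  qed
  have "card ?T \<le> (card J * (m * E) + 1) ^ card I" by (rule card_monomials_le[OF I])
  also have "\<dots> \<le> ((m + 1) * (card J * E + 1)) ^ card I"
    by (intro power_mono) (auto simp: algebra_simps)
  also have "\<dots> = (m + 1) ^ card I * m" unfolding power_mult_distrib m_def ..
  also have "\<dots> < (m + 1) ^ Suc (card I)" by simp
  also have "\<dots> \<le> (m + 1) ^ card J" using assms(3) by (intro power_increasing) auto
  also have "\<dots> = card (J \<rightarrow>\<^sub>E {..m})" using J by (simp add: card_PiE)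
  finally obtain u where u: "\<exists>\<alpha>\<in>J \<rightarrow>\<^sub>E {..m}. u \<alpha> \<noteq> 0"
    "\<And>x. (\<Sum>\<alpha>\<in>J \<rightarrow>\<^sub>E {..m}. u \<alpha> * (\<Prod>j\<in>J. F j x ^ \<alpha> j)) = 0"
    using family_dependent_if_many[of "J \<rightarrow>\<^sub>E {..m}" ?T "\<lambda>\<alpha> x. \<Prod>j\<in>J. F j x ^ \<alpha> j"]
      span finite_monomials[OF I] J by (auto intro: finite_PiE)
  define P where "P y = (\<Sum>\<alpha>\<in>J \<rightarrow>\<^sub>E {..m}. u \<alpha> * (\<Prod>j\<in>J. y j ^ \<alpha> j))" for y
  have "polyf J P"
    unfolding P_def by (intro polyf_sum polyf.mult polyf.const polyf_prod polyf_power polyf.coord)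
  then have "P y = 0" for y
    using indep u(2) unfolding indep_on_def P_def by auto
  then show False
    using polyf_monomials_independent[OF J, where m = m and u = u] u(1) unfolding P_def by blast
qed

section \<open>Closed sets, irreducibility and chains\<close>

lemma zariski_closed_zero_locus:
  assumes "zariski_closed n Z" "poly_fun n f"
  shows "zariski_closed n {X \<in> Z. f X = 0}"
proof -
  obtain F where "\<forall>f\<in>F. poly_fun n f" "Z = {X \<in> carrier_mat n n. \<forall>f\<in>F. f X = 0}"
    using assms(1) unfolding zariski_closed_def by blast
  then show ?thesis
    unfolding zariski_closed_def by (intro exI[of _ "insert f F"]) (use assms(2) in auto)
qed

lemma zariski_closed_separate:
  assumes "zariski_closed n Z" "X \<in> carrier_mat n n" "X \<notin> Z"
  shows "\<exists>f. poly_fun n f \<and> (\<forall>Y\<in>Z. f Y = 0) \<and> f X \<noteq> 0"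
  using assms unfolding zariski_closed_def by blast

lemma zariski_closed_carrier: "zariski_closed n Z \<Longrightarrow> Z \<subseteq> carrier_mat n n"
  unfolding zariski_closed_def by blast

text \<open>The two zero loci cover \<open>Z\<close>, so one of them is all of it: the vanishing
  ideal of \<open>Z\<close> is prime.\<close>

lemma irreducible_closed_prime:
  assumes Z: "irreducible_closed n Z" and f: "poly_fun n f" and g: "poly_fun n g"
    and fg: "\<And>X. X \<in> Z \<Longrightarrow> f X * g X = 0"
  shows "(\<forall>X\<in>Z. f X = 0) \<or> (\<forall>X\<in>Z. g X = 0)"
proof -
  have c: "zariski_closed n Z" using Z unfolding irreducible_closed_def by blast
  have "Z = {X \<in> Z. f X = 0} \<union> {X \<in> Z. g X = 0}" using fg by auto
  then have "Z = {X \<in> Z. f X = 0} \<or> Z = {X \<in> Z. g X = 0}"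
    using Z zariski_closed_zero_locus[OF c f] zariski_closed_zero_locus[OF c g]
    unfolding irreducible_closed_def by blast
  then show ?thesis by blast
qed

lemma indep_on_mono: "indep_on S f I \<Longrightarrow> S \<subseteq> T \<Longrightarrow> indep_on T f I"
  unfolding indep_on_def by blast

text \<open>The new function \<open>h\<close> vanishes on \<open>Y\<close> but not on
  \<open>Z\<close>. A relation on \<open>Z\<close> is divided by the highest power of the variable
  \<open>y d\<close>; primeness cancels \<open>h ^ k\<close>, and on \<open>Y\<close>, where
  \<open>h = 0\<close>, the cofactor would be a nontrivial relation among the old functions.\<close>

lemma indep_on_extend:
  fixes Y Z :: "'a :: field mat set"
  assumes Z: "irreducible_closed n Z" and Y: "zariski_closed n Y" "Y \<subset> Z"
    and f: "\<And>i. i < d \<Longrightarrow> poly_fun n (f i)" and indep: "indep_on Y f {..<d}"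
  shows "\<exists>g. (\<forall>i<Suc d. poly_fun n (g i)) \<and> indep_on Z g {..<Suc d}"
proof -
  have "zariski_closed n Z" using Z unfolding irreducible_closed_def by blast
  then have "Z \<subseteq> carrier_mat n n" by (rule zariski_closed_carrier)
  moreover obtain X0 where X0: "X0 \<in> Z" "X0 \<notin> Y" using Y(2) by blast
  ultimately have "X0 \<in> carrier_mat n n" by blast
  from zariski_closed_separate[OF Y(1) this X0(2)] X0(1)
  obtain h where h: "poly_fun n h" "\<forall>X\<in>Y. h X = 0" "\<exists>X\<in>Z. h X \<noteq> 0" by blast
  define g where "g = f(d := h)"
  have g: "poly_fun n (g i)" if "i \<in> insert d {..<d}" for i
    using that f h(1) unfolding g_def by auto
  have "P y = 0" if P: "polyf {..<Suc d} P" and 0: "\<forall>X\<in>Z. P (\<lambda>i. g i X) = 0" for P y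
  proof (rule ccontr)
    assume "P y \<noteq> 0"
    have "polyf (insert d {..<d}) P" using P by (simp add: lessThan_Suc)
    from polyf_factor[of d "{..<d}" P y, OF this \<open>P y \<noteq> 0\<close>] obtain k Q z where Q: "polyf (insert d {..<d}) Q"
      "\<And>y. P y = y d ^ k * Q y" "z d = 0" "Q z \<noteq> 0" by blast
    have hk: "poly_fun n (\<lambda>X. h X ^ k)"
      by (induction k) (auto intro: poly_fun.intros h)
    have "(\<forall>X\<in>Z. h X ^ k = 0) \<or> (\<forall>X\<in>Z. Q (\<lambda>i. g i X) = 0)"
      by (rule irreducible_closed_prime[OF Z hk poly_fun_subst[OF Q(1) g]])
        (use 0 Q(2) in \<open>auto simp: g_def\<close>)
    then have Q0: "Q (\<lambda>i. g i X) = 0" if "X \<in> Y" for X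
      using h(3) Y(2) that by auto
    have "polyf {..<d} (\<lambda>y. Q (\<lambda>i. (if i = d then \<lambda>_. 0 else (\<lambda>y. y i)) y))"
      by (rule polyf_subst[OF Q(1)]) (auto intro: polyf.intros)
    moreover have "Q (\<lambda>i. (if i = d then \<lambda>_. 0 else (\<lambda>y. y i)) (\<lambda>i. f i X)) = 0" if "X \<in> Y" for X
      using Q0[OF that] polyf_cong[OF Q(1), of "\<lambda>i. g i X"] h(2) that by (auto simp: g_def)
    ultimately have "Q (\<lambda>i. (if i = d then \<lambda>_. 0 else (\<lambda>y. y i)) z) = 0"
      using indep unfolding indep_on_def by blast
    moreover have "(\<lambda>i. (if i = d then \<lambda>_. 0 else (\<lambda>y. y i)) z) = z" using Q(3) by auto
    ultimately show False using Q(4) by simp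
  qed
  then show ?thesis
    using g unfolding indep_on_def by (intro exI[of _ g]) (auto simp: less_Suc_eq)
qed

lemma chain_indep:
  fixes Z :: "nat \<Rightarrow> 'a :: field mat set"
  assumes "\<And>i. i \<le> d \<Longrightarrow> irreducible_closed n (Z i)" "\<And>i. i < d \<Longrightarrow> Z i \<subset> Z (Suc i)"
  shows "\<exists>f. (\<forall>i<d. poly_fun n (f i)) \<and> indep_on (Z d) f {..<d}"
  using assms
proof (induction d)
  case 0
  \<comment> \<open>A relation in no variables is a constant, and it is zero because
    \<open>Z 0\<close> has a point.\<close>
  have *: "P y = 0" if "polyf {} P" "\<forall>X\<in>Z 0. P (\<lambda>i. 0) = 0" for P :: "(nat \<Rightarrow> 'a) \<Rightarrow> 'a" and y
  proof -
    obtain X where "X \<in> Z 0" using 0(1)[of 0] unfolding irreducible_closed_def by blast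
    then show ?thesis using that(2) polyf_cong[OF that(1), of y "\<lambda>i. 0"] by auto
  qed
  have "indep_on (Z 0) (\<lambda>(_ :: nat) _. 0 :: 'a) {..<0}"
    unfolding indep_on_def
  proof (intro allI impI)
    fix P :: "(nat \<Rightarrow> 'a) \<Rightarrow> 'a" and y
    assume "polyf {..<0} P" "\<forall>X\<in>Z 0. P (\<lambda>i. 0) = 0"
    then show "P y = 0" using *[of P y] by simp
  qed
  then show ?case by auto
next
  case (Suc d)
  have "\<exists>f. (\<forall>i<d. poly_fun n (f i)) \<and> indep_on (Z d) f {..<d}"
    by (rule Suc.IH) (simp_all add: Suc.prems)
  then obtain f where f: "\<And>i. i < d \<Longrightarrow> poly_fun n (f i)" "indep_on (Z d) f {..<d}" by blast
  have "zariski_closed n (Z d)" using Suc.prems(1)[of d] unfolding irreducible_closed_def by simp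
  then show ?case
    by (rule indep_on_extend[OF Suc.prems(1)[OF order_refl] _ Suc.prems(2)[OF lessI] f])
qed

lemma polyf_prod_nonzero:
  fixes P :: "'k \<Rightarrow> ('i \<Rightarrow> 'a :: field_char_0) \<Rightarrow> 'a"
  assumes "finite F" "\<And>k. k \<in> F \<Longrightarrow> polyf I (P k)" "\<And>k. k \<in> F \<Longrightarrow> \<exists>y. P k y \<noteq> 0"
  shows "\<exists>y. (\<Prod>k\<in>F. P k y) \<noteq> 0"
  using assms
proof (induction F rule: finite_induct)
  case empty
  then show ?case by simp
next
  case (insert k F)
  obtain x y where "P k x \<noteq> 0" "(\<Prod>k\<in>F. P k y) \<noteq> 0"
    using insert.IH insert.prems by blast
  then show ?case
    using polyf_common_nonzero[of I "P k" x "\<lambda>y. \<Prod>k\<in>F. P k y" y] insert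
    by (force intro: polyf_prod)
qed

text \<open>For a chain longer than \<open>N\<close> the functions from \<open>chain_indep\<close>
  are dependent along every chart, which has at most \<open>N\<close> parameters. The product of
  these finitely many relations holds on all of \<open>V\<close>, contradicting independence on the
  top of the chain.\<close>

lemma variety_dim_le:
  fixes V :: "'a :: field_char_0 mat set" and \<phi> :: "'k \<Rightarrow> ('i \<Rightarrow> 'a) \<Rightarrow> 'a mat"
  assumes F: "finite F" and V: "V \<subseteq> (\<Union>k\<in>F. range (\<phi> k))"
    and \<phi>: "\<And>k f. k \<in> F \<Longrightarrow> poly_fun n f \<Longrightarrow> polyf (I k) (\<lambda>x. f (\<phi> k x))"
    and I: "\<And>k. k \<in> F \<Longrightarrow> finite (I k)" "\<And>k. k \<in> F \<Longrightarrow> card (I k) \<le> N"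
  shows "variety_dim n V \<le> enat N"
  unfolding variety_dim_def
proof (rule Sup_least, clarify)
  fix d and Z :: "nat \<Rightarrow> 'a mat set"
  assume Z: "\<forall>i\<le>d. irreducible_closed n (Z i) \<and> Z i \<subseteq> V" "\<forall>i<d. Z i \<subset> Z (Suc i)"
  obtain f where f: "\<forall>i<d. poly_fun n (f i)" "indep_on (Z d) f {..<d}"
    using chain_indep[of d n Z] Z by auto
  show "enat d \<le> enat N"
  proof (rule ccontr)
    assume "\<not> ?thesis"
    then have d: "N < d" by simp
    have "\<not> indep_on UNIV (\<lambda>i x. f i (\<phi> k x)) {..<d}" if "k \<in> F" for k
      using I[OF that] d f(1) \<phi>[OF that] by (intro polyf_dependent[of "I k"]) auto
    then obtain P where P: "\<And>k. k \<in> F \<Longrightarrow> polyf {..<d} (P k)"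
      "\<And>k x. k \<in> F \<Longrightarrow> P k (\<lambda>i. f i (\<phi> k x)) = 0" "\<And>k. k \<in> F \<Longrightarrow> \<exists>y. P k y \<noteq> 0"
      unfolding indep_on_def by (simp; metis)
    have "(\<Prod>k\<in>F. P k (\<lambda>i. f i X)) = 0" if "X \<in> Z d" for X
    proof -
      have "X \<in> V" using Z(1) that by auto
      then obtain k x where "k \<in> F" "X = \<phi> k x" using V by blast
      then show ?thesis using P(2) F by auto
    qed
    then have "(\<Prod>k\<in>F. P k y) = 0" for y
      using f(2) polyf_prod[of F "{..<d}" P] P(1) unfolding indep_on_def by auto
    then show False using polyf_prod_nonzero[OF F, of "{..<d}" P] P(1,3) by blast
  qed
qed

section \<open>Zariski closures of images and the lower bound\<close>

definition zclosure :: "nat \<Rightarrow> 'a :: field mat set \<Rightarrow> 'a mat set" where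
  "zclosure n S =
     {X \<in> carrier_mat n n. \<forall>f. poly_fun n f \<longrightarrow> (\<forall>Y\<in>S. f Y = 0) \<longrightarrow> f X = 0}"

lemma zariski_closed_zclosure: "zariski_closed n (zclosure n S)"
  unfolding zariski_closed_def zclosure_def
  by (intro exI[of _ "{f. poly_fun n f \<and> (\<forall>Y\<in>S. f Y = 0)}"]) auto

lemma zclosure_superset: "S \<subseteq> carrier_mat n n \<Longrightarrow> S \<subseteq> zclosure n S"
  unfolding zclosure_def by auto

lemma zclosure_mono: "S \<subseteq> T \<Longrightarrow> zclosure n S \<subseteq> zclosure n T"
  unfolding zclosure_def by blast

lemma zclosure_minimal: "zariski_closed n V \<Longrightarrow> S \<subseteq> V \<Longrightarrow> zclosure n S \<subseteq> V"
  unfolding zariski_closed_def zclosure_def by blast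

lemma indep_on_zclosure:
  assumes f: "\<And>i. i \<in> I \<Longrightarrow> poly_fun n (f i)" and "indep_on (zclosure n S) f I"
  shows "indep_on S f I"
  unfolding indep_on_def
proof (intro allI impI)
  fix P y assume P: "polyf I P" "\<forall>X\<in>S. P (\<lambda>i. f i X) = 0"
  have "poly_fun n (\<lambda>X. P (\<lambda>i. f i X))" by (rule poly_fun_subst[OF P(1) f])
  then have "\<forall>X\<in>zclosure n S. P (\<lambda>i. f i X) = 0" using P(2) unfolding zclosure_def by blast
  then show "P y = 0" using assms(2) P(1) unfolding indep_on_def by blast
qed

text \<open>If two closed sets cover the closure and each misses a point of the image, the line
  joining the two parameters, which stays in the coordinate subspace, contains a parameter whose
  image avoids both.\<close>

lemma irreducible_closed_image:
  fixes \<phi> :: "('i \<Rightarrow> 'a :: field_char_0) \<Rightarrow> 'a mat"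
  assumes \<phi>: "\<And>f. poly_fun n f \<Longrightarrow> polyf I (\<lambda>x. f (\<phi> x))" "\<And>x. \<phi> x \<in> carrier_mat n n"
  shows "irreducible_closed n (zclosure n (\<phi> ` {x. \<forall>i. i \<notin> J \<longrightarrow> x i = 0}))"
proof -
  let ?L = "{x :: 'i \<Rightarrow> 'a. \<forall>i. i \<notin> J \<longrightarrow> x i = 0}"
  let ?Z = "zclosure n (\<phi> ` ?L)"
  have sup: "\<phi> ` ?L \<subseteq> ?Z" by (rule zclosure_superset) (use \<phi>(2) in auto)
  have L: "(\<lambda>_. 0) \<in> ?L" by simp
  have *: "?Z = Z1 \<or> ?Z = Z2"
    if Z1: "zariski_closed n Z1" and Z2: "zariski_closed n Z2" and U: "?Z = Z1 \<union> Z2" for Z1 Z2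
  proof (rule ccontr)
    assume no: "\<not> ?thesis"
    have "\<not> \<phi> ` ?L \<subseteq> Z1"
    proof
      assume "\<phi> ` ?L \<subseteq> Z1"
      then have "?Z \<subseteq> Z1" by (rule zclosure_minimal[OF Z1])
      then show False using U no by auto
    qed
    moreover have "\<not> \<phi> ` ?L \<subseteq> Z2"
    proof
      assume "\<phi> ` ?L \<subseteq> Z2"
      then have "?Z \<subseteq> Z2" by (rule zclosure_minimal[OF Z2])
      then show False using U no by auto
    qed
    ultimately obtain x y where x: "x \<in> ?L" "\<phi> x \<notin> Z1" and y: "y \<in> ?L" "\<phi> y \<notin> Z2" by auto
    obtain f where f: "poly_fun n f" "\<forall>Y\<in>Z1. f Y = 0" "f (\<phi> x) \<noteq> 0"
      using zariski_closed_separate[OF Z1 \<phi>(2) x(2)] by blast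
    obtain g where g: "poly_fun n g" "\<forall>Y\<in>Z2. g Y = 0" "g (\<phi> y) \<noteq> 0"
      using zariski_closed_separate[OF Z2 \<phi>(2) y(2)] by blast
    obtain t where t: "f (\<phi> (\<lambda>i. x i + t * (y i - x i))) \<noteq> 0"
      "g (\<phi> (\<lambda>i. x i + t * (y i - x i))) \<noteq> 0"
      using polyf_common_nonzero[of I "\<lambda>x. f (\<phi> x)" x "\<lambda>x. g (\<phi> x)" y] \<phi>(1) f(1,3) g(1,3)
      by blast
    have "(\<lambda>i. x i + t * (y i - x i)) \<in> ?L" using x(1) y(1) by auto
    then have "\<phi> (\<lambda>i. x i + t * (y i - x i)) \<in> ?Z" by (intro subsetD[OF sup] imageI)
    then have "\<phi> (\<lambda>i. x i + t * (y i - x i)) \<in> Z1 \<union> Z2" unfolding U .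
    then show False using t f(2) g(2) by auto
  qed
  have "\<phi> (\<lambda>_. 0) \<in> ?Z" by (intro subsetD[OF sup] imageI L)
  then have "?Z \<noteq> {}" by (metis empty_iff)
  then show ?thesis
    unfolding irreducible_closed_def
    by (intro conjI allI impI zariski_closed_zclosure *) auto
qed

text \<open>The lowest-order part of a relation among functions with linear parts \<open>x\<^sub>i\<close> would be a
  relation among the coordinates themselves.\<close>

lemma indep_on_identity_jet:
  fixes F :: "'i \<Rightarrow> ('i \<Rightarrow> 'a :: field_char_0) \<Rightarrow> 'a"
  assumes F: "\<And>i x. i \<in> J \<Longrightarrow> \<exists>h. \<forall>t. F i (\<lambda>j. t * x j) = t * x i + t ^ 2 * poly h t"
  shows "indep_on {x. \<forall>i. i \<notin> J \<longrightarrow> x i = 0} F J"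
  unfolding indep_on_def
proof (intro allI impI, rule ccontr)
  fix P y
  assume P: "polyf J P" and 0: "\<forall>x\<in>{x. \<forall>i. i \<notin> J \<longrightarrow> x i = 0}. P (\<lambda>i. F i x) = 0"
    and y: "P y \<noteq> 0"
  \<comment> \<open>The variable \<open>None\<close> is a scaling factor: the power of it dividing
    \<open>P'\<close> is the lowest degree occurring in \<open>P\<close>, and the cofactor at
    \<open>None = 0\<close> is the lowest homogeneous part.\<close>
  define P' where "P' z = P (\<lambda>i. z None * z (Some i))" for z :: "'i option \<Rightarrow> 'a"
  have P': "polyf (insert None (Some ` J)) P'"
    unfolding P'_def by (rule polyf_subst[OF P]) (rule polyf.mult; rule polyf.coord; simp)
  have "P' (case_option 1 y) \<noteq> 0" using y unfolding P'_def by simp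
  from polyf_factor[of None "Some ` J" P' "case_option 1 y", OF P' this] obtain k Q z where Q: "polyf (insert None (Some ` J)) Q"
    "\<And>z. P' z = z None ^ k * Q z" "z None = 0" "Q z \<noteq> 0" by blast
  define x where "x i = (if i \<in> J then z (Some i) else 0)" for i
  obtain h where h: "\<And>i t. i \<in> J \<Longrightarrow> F i (\<lambda>j. t * x j) = t * x i + t ^ 2 * poly (h i) t"
    using F[of _ x] by metis
  \<comment> \<open>Multiplying the \<open>Some\<close> coordinates of \<open>w t\<close> by
    \<open>t\<close> gives the values of \<open>F\<close> at \<open>t * x\<close>, so
    \<open>P'\<close> vanishes along \<open>w\<close>; moreover \<open>w 0\<close> agrees with
    \<open>z\<close> on the variables of \<open>Q\<close>.\<close>
  define w where "w t = case_option t (\<lambda>i. x i + t * poly (h i) t)" for t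
  have w: "\<exists>g. \<forall>t. w t i = poly g t" for i
  proof (cases i)
    case None
    then show ?thesis unfolding w_def by (intro exI[of _ "[:0, 1:]"]) simp
  next
    case (Some j)
    then show ?thesis unfolding w_def by (intro exI[of _ "[:x j:] + [:0, 1:] * h j"]) simp
  qed
  obtain g where g: "\<And>t. Q (w t) = poly g t" using polyf_along_curve[OF Q(1), of w] w by blast
  \<comment> \<open>Cancelling \<open>t ^ k\<close> requires \<open>t \<noteq> 0\<close>; a
    polynomial that vanishes off \<open>0\<close> also vanishes at \<open>0\<close>.\<close>
  have "poly g t = 0" if "t \<notin> {0}" for t
  proof -
    have "P' (w t) = P (\<lambda>i. F i (\<lambda>j. t * x j))"
      unfolding P'_def
      by (rule polyf_cong[OF P]) (simp add: w_def h algebra_simps power2_eq_square)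
    also have "\<dots> = 0" using 0 by (simp add: x_def)
    finally have "t ^ k * Q (w t) = 0" using Q(2)[of "w t"] by (simp add: w_def)
    then show ?thesis using that g by simp
  qed
  then have "g = 0" by (intro poly_eq_0_if_almost_everywhere[of "{0}"]) auto
  then have "Q (w 0) = 0" using g by simp
  moreover have "Q (w 0) = Q z"
    by (rule polyf_cong[OF Q(1)]) (auto simp: w_def x_def Q(3))
  ultimately show False using Q(4) by simp
qed

text \<open>The functions \<open>\<psi> i\<close> recover the parameters to first order at the
  origin, so \<open>indep_on_identity_jet\<close> makes them independent on the image of each
  coordinate subspace. If two consecutive closures were equal, \<open>Suc j\<close> such functions
  would be independent on a space with only \<open>j\<close> coordinates.\<close>

lemma variety_dim_ge:
  fixes \<phi> :: "('i \<Rightarrow> 'a :: field_char_0) \<Rightarrow> 'a mat"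
  assumes V: "zariski_closed n V" and I: "finite I"
    and \<phi>: "\<And>f. poly_fun n f \<Longrightarrow> polyf I (\<lambda>x. f (\<phi> x))" "\<And>x. \<phi> x \<in> V"
    and \<psi>: "\<And>i. i \<in> I \<Longrightarrow> poly_fun n (\<psi> i)"
    and jet: "\<And>i x. i \<in> I \<Longrightarrow> \<exists>h. \<forall>t. \<psi> i (\<phi> (\<lambda>j. t * x j)) = t * x i + t ^ 2 * poly h t"
  shows "enat (card I) \<le> variety_dim n V"
proof -
  obtain e where e: "bij_betw e {..<card I} I"
    using ex_bij_betw_nat_finite[OF I] atLeast0LessThan by metis
  define L :: "nat \<Rightarrow> ('i \<Rightarrow> 'a) set" where "L j = {x. \<forall>i. i \<notin> e ` {..<j} \<longrightarrow> x i = 0}" for j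
  define Z where "Z j = zclosure n (\<phi> ` L j)" for j
  have carrier: "\<phi> x \<in> carrier_mat n n" for x
    using zariski_closed_carrier[OF V] \<phi>(2) by blast
  have sup: "\<phi> ` L j \<subseteq> Z j" for j
    unfolding Z_def by (rule zclosure_superset) (use carrier in auto)
  have "irreducible_closed n (Z j)" for j
    unfolding Z_def L_def by (rule irreducible_closed_image[where \<phi> = \<phi> and I = I]) (rule \<phi>(1), assumption, rule carrier)
  moreover have "Z j \<subseteq> V" for j
    unfolding Z_def by (rule zclosure_minimal[OF V]) (use \<phi>(2) in auto)
  moreover have "Z j \<subset> Z (Suc j)" if j: "j < card I" for j
  proof
    show "Z j \<subseteq> Z (Suc j)"
      unfolding Z_def L_def by (intro zclosure_mono image_mono) (auto simp: lessThan_Suc)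
    show "Z j \<noteq> Z (Suc j)"
    proof
      assume eq: "Z j = Z (Suc j)"
      let ?J = "e ` {..<j}" and ?J' = "e ` {..<Suc j}"
      have J': "?J' \<subseteq> I" using e j unfolding bij_betw_def by auto
      have inj: "inj_on e {..<Suc j}" "inj_on e {..<j}"
        using e j by (auto simp: bij_betw_def intro: inj_on_subset)
      have "indep_on (L (Suc j)) (\<lambda>i x. \<psi> i (\<phi> x)) ?J'"
        unfolding L_def by (rule indep_on_identity_jet) (use jet J' in blast)
      then have "indep_on (\<phi> ` L (Suc j)) \<psi> ?J'" unfolding indep_on_def by simp
      then have "indep_on (Z j) \<psi> ?J'" unfolding eq by (rule indep_on_mono[OF _ sup])
      then have "indep_on (\<phi> ` L j) \<psi> ?J'"
        unfolding Z_def by (rule indep_on_zclosure[rotated]) (use \<psi> J' in blast)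
      then have ind: "indep_on (L j) (\<lambda>i x. \<psi> i (\<phi> x)) ?J'" unfolding indep_on_def by simp
      \<comment> \<open>Composing with this projection onto \<open>L j\<close> replaces functions on
        \<open>L j\<close> by polynomials in the variables \<open>?J\<close> on the whole
        space.\<close>
      define r where "r x = (\<lambda>i. if i \<in> ?J then x i else 0)" for x :: "'i \<Rightarrow> 'a"
      have r: "r x \<in> L j" "x \<in> L j \<Longrightarrow> r x = x" for x unfolding L_def r_def by auto
      have "indep_on UNIV (\<lambda>i x. \<psi> i (\<phi> (r x))) ?J'"
        using ind r unfolding indep_on_def by (metis UNIV_I)
      moreover have "polyf ?J (\<lambda>x. \<psi> i (\<phi> (r x)))" if "i \<in> ?J'" for i
      proof -
        have p: "polyf I (\<lambda>x. \<psi> i (\<phi> x))" using \<phi>(1) \<psi> J' that by blast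
        have "polyf ?J (\<lambda>x. if i \<in> ?J then x i else 0)" for i
          by (cases "i \<in> ?J") (auto intro: polyf.intros)
        then show ?thesis unfolding r_def by (rule polyf_subst[OF p])
      qed
      ultimately show False
        using polyf_dependent[of ?J ?J' "\<lambda>i x. \<psi> i (\<phi> (r x))"] card_image[OF inj(1)] card_image[OF inj(2)]
        by auto
    qed
  qed
  ultimately show ?thesis
    unfolding variety_dim_def by (intro Sup_upper) blast
qed

section \<open>The matrix equation in blocks\<close>

lemma four_block_mat_inject:
  assumes "A \<in> carrier_mat p r" "B \<in> carrier_mat p s" "C \<in> carrier_mat q r" "D \<in> carrier_mat q s"
    and "A' \<in> carrier_mat p r" "B' \<in> carrier_mat p s" "C' \<in> carrier_mat q r" "D' \<in> carrier_mat q s"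
  shows "four_block_mat A B C D = four_block_mat A' B' C' D' \<longleftrightarrow> A = A' \<and> B = B' \<and> C = C' \<and> D = D'"
proof
  assume eq: "four_block_mat A B C D = four_block_mat A' B' C' D'"
  have e: "four_block_mat A B C D $$ (i, j) = four_block_mat A' B' C' D' $$ (i, j)" for i j
    using eq by simp
  have "A $$ (i, j) = A' $$ (i, j)" if "i < p" "j < r" for i j
    using e[of i j] that assms by simp
  moreover have "B $$ (i, j) = B' $$ (i, j)" if "i < p" "j < s" for i j
    using e[of i "j + r"] that assms by simp
  moreover have "C $$ (i, j) = C' $$ (i, j)" if "i < q" "j < r" for i j
    using e[of "i + p" j] that assms by simp
  moreover have "D $$ (i, j) = D' $$ (i, j)" if "i < q" "j < s" for i j
    using e[of "i + p" "j + r"] that assms by simp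
  ultimately show "A = A' \<and> B = B' \<and> C = C' \<and> D = D'"
    using assms by (auto intro!: eq_matI)
qed simp

lemma minus_four_block_mat:
  assumes "A \<in> carrier_mat p r" "B \<in> carrier_mat p s" "C \<in> carrier_mat q r" "D \<in> carrier_mat q s"
    and "A' \<in> carrier_mat p r" "B' \<in> carrier_mat p s" "C' \<in> carrier_mat q r" "D' \<in> carrier_mat q s"
  shows "four_block_mat A B C D - four_block_mat A' B' C' D' =
    four_block_mat (A - A') (B - B') (C - C') (D - D')"
  by (rule eq_matI) (use assms in auto)

lemma diff_mat_eq_0_iff:
  fixes M N :: "'a :: ab_group_add mat"
  assumes "M \<in> carrier_mat m k" "N \<in> carrier_mat m k"
  shows "M - N = 0\<^sub>m m k \<longleftrightarrow> M = N"
proof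
  assume e: "M - N = 0\<^sub>m m k"
  have "(M - N) $$ (i, j) = 0" if "i < m" "j < k" for i j using e that by simp
  then show "M = N" using assms by (intro eq_matI) auto
next
  assume "M = N"
  then show "M - N = 0\<^sub>m m k" using assms by (intro eq_matI) auto
qed

text \<open>The off-diagonal blocks of \<open>X\<^sup>2 - X\<^sup>3\<close> have this shape and get
  multiplied by \<open>P\<close> or \<open>S\<close>.\<close>

lemma mult_three_term_mat:
  fixes Z :: "'a :: ring mat"
  assumes Z: "Z \<in> carrier_mat k m" and c: "M \<in> carrier_mat m n" "N \<in> carrier_mat m n"
  shows "Z * (M + M - (N + (N + N))) = Z * M + Z * M - (Z * N + (Z * N + Z * N))"
  using c mult_minus_distrib_mat[OF Z, of "M + M" n "N + (N + N)"]
    mult_add_distrib_mat[OF Z, of M n M] mult_add_distrib_mat[OF Z, of N n "N + N"]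
    mult_add_distrib_mat[OF Z, of N n N]
  by (metis add_carrier_mat)

text \<open>Once \<open>Q R\<close> and \<open>R Q\<close> vanish, the off-diagonal blocks read
  \<open>- Q = 2 P Q - 3 P\<^sup>2 Q\<close> and \<open>R = 2 S R - 3 S\<^sup>2 R\<close>. The
  different signs on the left are why \<open>Q\<close> survives with \<open>P Q = Q\<close> whereas
  \<open>R\<close> must be zero.\<close>

lemma commutator_equation_iff:
  fixes P Q R S :: "'a :: field_char_0 mat"
  assumes P: "P \<in> carrier_mat p p" and Q: "Q \<in> carrier_mat p q"
    and R: "R \<in> carrier_mat q p" and S: "S \<in> carrier_mat q q"
    and A: "A = four_block_mat (1\<^sub>m p) (0\<^sub>m p q) (0\<^sub>m q p) (0\<^sub>m q q)"
    and X: "X = four_block_mat P Q R S"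
  shows "X * A - A * X = X * X - X * X * X \<longleftrightarrow>
    R = 0\<^sub>m q p \<and> P * P * P = P * P \<and> S * S * S = S * S \<and> P * Q = Q \<and> Q * S = Q"
proof -
  note PQRS = P Q R S
  have Xc: "X \<in> carrier_mat (p + q) (p + q)" using PQRS X by simp
  have XA: "X * A - A * X = four_block_mat (0\<^sub>m p p) (- Q) R (0\<^sub>m q q)"
  proof -
    have "X * A = four_block_mat P (0\<^sub>m p q) R (0\<^sub>m q q)"
      unfolding X A using PQRS by (subst mult_four_block_mat) auto
    moreover have "A * X = four_block_mat P Q (0\<^sub>m q p) (0\<^sub>m q q)"
      unfolding X A using PQRS by (subst mult_four_block_mat) auto
    ultimately show ?thesis
      using PQRS by (auto simp: minus_four_block_mat intro!: cong_four_block_mat eq_matI)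
  qed
  have XX: "X * X = four_block_mat (P * P + Q * R) (P * Q + Q * S) (R * P + S * R) (R * Q + S * S)"
    unfolding X using PQRS by (subst mult_four_block_mat) auto
  show ?thesis
  proof
    assume eq: "X * A - A * X = X * X - X * X * X"
    define Y where "Y = four_block_mat (0\<^sub>m p p) (- Q) R (0\<^sub>m q q)"
    have Y: "X * X - X * X * X = Y" using eq XA Y_def by simp
    \<comment> \<open>Being a polynomial in \<open>X\<close>, the matrix \<open>Y\<close> commutes
      with \<open>X\<close>; comparing blocks then yields the vanishing products.\<close>
    have "X * Y = X * (X * X) - X * (X * X * X)"
      unfolding Y[symmetric] using Xc by (intro mult_minus_distrib_mat) auto
    also have "\<dots> = X * X * X - X * X * X * X" using Xc by (simp add: assoc_mult_mat[of _ "p + q" "p + q" _ "p + q" _ "p + q"])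
    also have "\<dots> = Y * X"
      unfolding Y[symmetric] using Xc by (intro minus_mult_distrib_mat[symmetric]) auto
    finally have "X * Y = Y * X" .
    moreover have "X * Y = four_block_mat (Q * R) (- (P * Q)) (S * R) (- (R * Q))"
      unfolding X Y_def using PQRS by (subst mult_four_block_mat) (auto intro!: cong_four_block_mat)
    moreover have "Y * X = four_block_mat (- (Q * R)) (- (Q * S)) (R * P) (R * Q)"
      unfolding X Y_def using PQRS by (subst mult_four_block_mat) (auto intro!: cong_four_block_mat)
    ultimately have "four_block_mat (Q * R) (- (P * Q)) (S * R) (- (R * Q)) =
        four_block_mat (- (Q * R)) (- (Q * S)) (R * P) (R * Q)" by simp
    then have "Q * R = - (Q * R) \<and> - (P * Q) = - (Q * S) \<and> S * R = R * P \<and> - (R * Q) = R * Q"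
      using PQRS by (subst (asm) four_block_mat_inject[of _ p p _ q _ q]) auto
    then have QR': "Q * R = - (Q * R)" and PQ: "Q * S = P * Q" and RP: "R * P = S * R"
      and RQ': "- (R * Q) = R * Q" by auto
    \<comment> \<open>Characteristic \<open>0\<close> enters here: an entry whose double is zero is
      zero.\<close>
    have zero: "M = 0\<^sub>m m k" if "M = - M" "M \<in> carrier_mat m k" for M :: "'a mat" and m k
    proof (rule eq_matI)
      fix i j assume "i < dim_row (0\<^sub>m m k :: 'a mat)" "j < dim_col (0\<^sub>m m k :: 'a mat)"
      then have "M $$ (i, j) = - (M $$ (i, j))"
        using arg_cong[OF that(1), of "\<lambda>M. M $$ (i, j)"] that(2) by simp
      then show "M $$ (i, j) = 0\<^sub>m m k $$ (i, j)"
        using \<open>i < _\<close> \<open>j < _\<close> by (simp add: eq_neg_iff_add_eq_0 flip: mult_2)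
    qed (use that in auto)
    have QR: "Q * R = 0\<^sub>m p p" using zero[OF QR'] PQRS by auto
    have RQ: "R * Q = 0\<^sub>m q q" using zero[OF RQ'[symmetric]] PQRS by auto
    have XX': "X * X = four_block_mat (P * P) (P * Q + P * Q) (S * R + S * R) (S * S)"
      unfolding XX QR RQ PQ RP using PQRS by (auto intro!: cong_four_block_mat)
    have a1: "(P * Q + P * Q) * R = 0\<^sub>m p p"
      using PQRS QR by (subst add_mult_distrib_mat[of _ p q]) (auto simp: assoc_mult_mat[of P p p Q q R p])
    have a2: "(S * R + S * R) * Q = 0\<^sub>m q q"
      using PQRS RQ by (subst add_mult_distrib_mat[of _ q p]) (auto simp: assoc_mult_mat[of S q q R p Q q])
    have a3: "(P * Q + P * Q) * S = P * (P * Q) + P * (P * Q)"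
      using PQRS PQ by (subst add_mult_distrib_mat[of _ p q]) (auto simp: assoc_mult_mat[of P p p Q q S q])
    have a4: "(S * R + S * R) * P = S * (S * R) + S * (S * R)"
      using PQRS RP by (subst add_mult_distrib_mat[of _ q p]) (auto simp: assoc_mult_mat[of S q q R p P p])
    have XXX: "X * X * X = four_block_mat (P * P * P)
      (P * (P * Q) + (P * (P * Q) + P * (P * Q))) (S * (S * R) + (S * (S * R) + S * (S * R))) (S * S * S)"
      unfolding XX' unfolding X using PQRS
      by (subst mult_four_block_mat[of _ p p _ q _ q])
        (auto intro!: cong_four_block_mat simp: a1 a2 a3 a4 assoc_mult_mat[of P p p P p Q q] assoc_mult_mat[of S q q S q R p]
          assoc_add_mat[of _ q p] comm_add_mat[of _ q p])
    have "X * X - X * X * X = four_block_mat (P * P - P * P * P)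
      (P * Q + P * Q - (P * (P * Q) + (P * (P * Q) + P * (P * Q))))
      (S * R + S * R - (S * (S * R) + (S * (S * R) + S * (S * R)))) (S * S - S * S * S)"
      unfolding XXX unfolding XX' using PQRS by (intro minus_four_block_mat) auto
    then have e': "0\<^sub>m p p = P * P - P * P * P \<and>
      - Q = P * Q + P * Q - (P * (P * Q) + (P * (P * Q) + P * (P * Q))) \<and>
      R = S * R + S * R - (S * (S * R) + (S * (S * R) + S * (S * R))) \<and>
      0\<^sub>m q q = S * S - S * S * S"
      unfolding Y Y_def
      by (rule iffD1[OF four_block_mat_inject[of _ p p _ q _ q], rotated -1]) (use PQRS in auto)
    note e = e'[THEN conjunct1, symmetric] e'[THEN conjunct2, THEN conjunct1, symmetric]
      e'[THEN conjunct2, THEN conjunct2, THEN conjunct1, symmetric]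
      e'[THEN conjunct2, THEN conjunct2, THEN conjunct2, symmetric]
    have PPP: "P * P * P = P * P"
      by (rule sym, rule diff_mat_eq_0_iff[THEN iffD1, of _ p p]) (use P e(1) in auto)
    have SSS: "S * S * S = S * S"
      by (rule sym, rule diff_mat_eq_0_iff[THEN iffD1, of _ q q]) (use S e(4) in auto)
    have stable: "Z * (Z * (Z * M)) = Z * (Z * M)"
      if "Z \<in> carrier_mat k k" "M \<in> carrier_mat k l" "Z * Z * Z = Z * Z" for Z M :: "'a mat" and k l
    proof -
      have "Z * (Z * (Z * M)) = Z * Z * Z * M"
        using that(1,2) by (simp add: assoc_mult_mat[of _ k k _ k _ l])
      also have "\<dots> = Z * (Z * M)" unfolding that(3) using that(1,2) by (rule assoc_mult_mat[OF _ that(1)])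
      finally show ?thesis .
    qed
    have sc: "x = y" if "x + x - (x + (x + x)) = - (y :: 'a)" for x y
      using that by (simp add: algebra_simps)
    \<comment> \<open>Multiplying the equation for \<open>Q\<close> by \<open>P\<close> and using
      \<open>P\<^sup>3 Q = P\<^sup>2 Q\<close> leaves \<open>- P Q = - P\<^sup>2 Q\<close>.\<close>
    have PPQ: "P * (P * Q) = P * Q"
    proof (rule eq_matI)
      have "P * (P * Q) + P * (P * Q) - (P * (P * Q) + (P * (P * Q) + P * (P * Q))) = - (P * Q)"
        using mult_three_term_mat[of P p p "P * Q" q "P * (P * Q)"] PQRS stable[OF P Q PPP] by (simp add: e(2))
      note E = arg_cong[OF this, of "\<lambda>M. M $$ (i, j)" for i j]
      show "(P * (P * Q)) $$ (i, j) = (P * Q) $$ (i, j)"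
        if "i < dim_row (P * Q)" "j < dim_col (P * Q)" for i j
        by (rule sc) (use E[of i j] that PQRS in \<open>simp del: index_mult_mat(1)\<close>)
    qed (use PQRS in auto)
    have "P * Q = Q"
    proof (rule eq_matI)
      have "P * Q + P * Q - (P * Q + (P * Q + P * Q)) = - Q" using e(2) unfolding PPQ .
      note E = arg_cong[OF this, of "\<lambda>M. M $$ (i, j)" for i j]
      show "(P * Q) $$ (i, j) = Q $$ (i, j)" if "i < dim_row Q" "j < dim_col Q" for i j
        by (rule sc) (use E[of i j] that PQRS in \<open>simp del: index_mult_mat(1)\<close>)
    qed (use PQRS in auto)
    \<comment> \<open>Multiplying the equation for \<open>R\<close> by \<open>S\<close> gives
      \<open>S\<^sup>2 R = - S R\<close>, and once more \<open>S\<^sup>3 R = - S\<^sup>2 R\<close>.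
      Since \<open>S\<^sup>3 R = S\<^sup>2 R\<close>, these products vanish and the equation returns
      \<open>R = 0\<close>.\<close>
    moreover have "R = 0\<^sub>m q p"
    proof -
      have 1: "S * (S * R) + S * (S * R) - (S * (S * R) + (S * (S * R) + S * (S * R))) = S * R"
        using mult_three_term_mat[of S q q "S * R" p "S * (S * R)"] PQRS stable[OF S R SSS] by (simp add: e(3))
      have 2: "S * (S * R) = - (S * R)"
      proof (rule eq_matI)
        note E = arg_cong[OF 1, of "\<lambda>M. M $$ (i, j)" for i j]
        show "(S * (S * R)) $$ (i, j) = (- (S * R)) $$ (i, j)"
          if "i < dim_row (- (S * R))" "j < dim_col (- (S * R))" for i j
        proof -
          have "- ((S * (S * R)) $$ (i, j)) = (S * R) $$ (i, j)"
            using E[of i j] that PQRS by (simp del: index_mult_mat(1))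
          then have "(S * (S * R)) $$ (i, j) = - ((S * R) $$ (i, j))" by (metis minus_minus)
          then show ?thesis using that PQRS by (simp del: index_mult_mat(1))
        qed
      qed (use PQRS in auto)
      have "S * (S * (S * R)) = - (S * (S * R))"
        using arg_cong[OF 2, of "(*) S"] uminus_mult_right_mat[of S "S * R"] S R by simp
      then have 0: "S * (S * R) = 0\<^sub>m q p"
        using zero[of "S * (S * R)" q p] R S unfolding stable[OF S R SSS] by simp
      have "S * R = 0\<^sub>m q p"
      proof -
        have "S * R = - (S * (S * R))" unfolding 2 by simp
        also have "\<dots> = 0\<^sub>m q p" unfolding 0 by (intro eq_matI) auto
        finally show ?thesis .
      qed
      then have "R = 0\<^sub>m q p + 0\<^sub>m q p - (0\<^sub>m q p + (0\<^sub>m q p + 0\<^sub>m q p))"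
        using e(3)[symmetric] unfolding 0 by (simp only:)
      then show ?thesis by simp
    qed
    ultimately show "R = 0\<^sub>m q p \<and> P * P * P = P * P \<and> S * S * S = S * S \<and> P * Q = Q \<and> Q * S = Q"
      using PPP SSS PQ by auto
  next
    assume h: "R = 0\<^sub>m q p \<and> P * P * P = P * P \<and> S * S * S = S * S \<and> P * Q = Q \<and> Q * S = Q"
    then have R0: "R = 0\<^sub>m q p" by blast
    have XX': "X * X = four_block_mat (P * P) (Q + Q) (0\<^sub>m q p) (S * S)"
      unfolding XX using h PQRS by (auto intro!: cong_four_block_mat)
    have "P * P * Q = Q" using h P Q by (metis assoc_mult_mat)
    moreover have "(Q + Q) * S = Q + Q"
      using h PQRS by (subst add_mult_distrib_mat[of _ p q]) auto
    ultimately have XXX: "X * X * X = four_block_mat (P * P) (Q + (Q + Q)) (0\<^sub>m q p) (S * S)"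
      unfolding XX' unfolding X R0 using h PQRS
      by (subst mult_four_block_mat[of _ p p _ q _ q]) (auto intro!: cong_four_block_mat)
    have "X * X - X * X * X =
        four_block_mat (P * P - P * P) (Q + Q - (Q + (Q + Q))) (0\<^sub>m q p - 0\<^sub>m q p) (S * S - S * S)"
      unfolding XXX unfolding XX' using PQRS by (intro minus_four_block_mat) auto
    also have "\<dots> = four_block_mat (0\<^sub>m p p) (- Q) R (0\<^sub>m q q)"
      using PQRS R0 by (intro cong_four_block_mat eq_matI) auto
    finally show "X * A - A * X = X * X - X * X * X" unfolding XA by simp
  qed
qed

section \<open>Charts\<close>

text \<open>Matrices are handled through entry functions, so that polynomiality and order of
  vanishing can be proved entry by entry.\<close>

definition fmat :: "nat \<Rightarrow> nat \<Rightarrow> (nat \<Rightarrow> nat \<Rightarrow> 'a) \<Rightarrow> 'a mat" where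
  "fmat m k f = mat m k (\<lambda>(i, j). f i j)"

lemma fmat_carrier [simp]: "fmat m k f \<in> carrier_mat m k"
  unfolding fmat_def by simp

lemma fmat_dim [simp]: "dim_row (fmat m k f) = m" "dim_col (fmat m k f) = k"
  unfolding fmat_def by simp_all

lemma fmat_index [simp]: "i < m \<Longrightarrow> j < k \<Longrightarrow> fmat m k f $$ (i, j) = f i j"
  unfolding fmat_def by simp

lemma fmat_cong: "(\<And>i j. i < m \<Longrightarrow> j < k \<Longrightarrow> f i j = g i j) \<Longrightarrow> fmat m k f = fmat m k g"
  by (intro eq_matI) auto

lemma fmat_entries: "M \<in> carrier_mat m k \<Longrightarrow> fmat m k (\<lambda>i j. M $$ (i, j)) = M"
  by (intro eq_matI) auto

lemma fmat_mult: "fmat m k f * fmat k l g = fmat m l (\<lambda>i j. \<Sum>s<k. f i s * g s j)"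
  by (intro eq_matI) (auto simp: scalar_prod_def lessThan_atLeast0)

lemma fmat_one: "1\<^sub>m m = fmat m m (\<lambda>i j. if i = j then 1 else 0)"
  by (intro eq_matI) auto

lemma sum_lessThan_add:
  "(\<Sum>k<m + n :: nat. f k) = (\<Sum>k<m. f k) + (\<Sum>l<n. f (m + l) :: 'b :: comm_monoid_add)"
  by (induction n) (auto simp: ac_simps)

text \<open>A matrix of rank \<open>r\<close> factors as \<open>C * R\<close>, where the rows of \<open>C\<close>, taken in the order \<open>\<tau>\<close>,
  are those of the identity followed by those of \<open>c\<close>. Given \<open>R * C = E\<close>, the factor \<open>R\<close> is
  determined by the remaining columns \<open>d\<close>.\<close>

definition left_factor :: "(nat \<Rightarrow> nat) \<Rightarrow> nat \<Rightarrow> (nat \<Rightarrow> nat \<Rightarrow> 'a :: field) \<Rightarrow> nat \<Rightarrow> nat \<Rightarrow> 'a" where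
  "left_factor \<tau> r c i j = (if \<tau> i < r then if \<tau> i = j then 1 else 0 else c (\<tau> i - r) j)"

definition right_factor :: "(nat \<Rightarrow> nat) \<Rightarrow> nat \<Rightarrow> nat \<Rightarrow> (nat \<Rightarrow> nat \<Rightarrow> 'a :: field) \<Rightarrow> (nat \<Rightarrow> nat \<Rightarrow> 'a) \<Rightarrow>
    (nat \<Rightarrow> nat \<Rightarrow> 'a) \<Rightarrow> nat \<Rightarrow> nat \<Rightarrow> 'a" where
  "right_factor \<tau> r m c d E i j =
     (if \<tau> j < r then E i (\<tau> j) - (\<Sum>l<m. d i l * c l (\<tau> j)) else d i (\<tau> j - r))"

text \<open>Summing in the order given by \<open>\<tau>\<close> meets the identity rows of the left
  factor first; they pick out one column of \<open>R\<close>, and the rest contributes through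
  \<open>c\<close>.\<close>

lemma sum_mult_left_factor:
  fixes R :: "nat \<Rightarrow> nat \<Rightarrow> 'a :: field"
  assumes \<tau>: "\<tau> permutes {..<r + m}" and j: "j < r"
  shows "(\<Sum>l<r + m. R i l * left_factor \<tau> r c l j) =
    R i (Hilbert_Choice.inv \<tau> j) + (\<Sum>l<m. R i (Hilbert_Choice.inv \<tau> (r + l)) * c l j)"
proof -
  have inv: "\<tau> (Hilbert_Choice.inv \<tau> k) = k" for k by (rule permutes_inverses(1)[OF \<tau>])
  have "(\<Sum>l<r + m. R i l * left_factor \<tau> r c l j) = (\<Sum>k<r + m. R i (Hilbert_Choice.inv \<tau> k) * left_factor \<tau> r c (Hilbert_Choice.inv \<tau> k) j)"
    by (rule sum.permute[OF permutes_inv[OF \<tau>], unfolded comp_def])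
  also have "\<dots> = (\<Sum>k<r. R i (Hilbert_Choice.inv \<tau> k) * (if k = j then 1 else 0)) +
      (\<Sum>l<m. R i (Hilbert_Choice.inv \<tau> (r + l)) * c l j)"
    unfolding sum_lessThan_add by (simp add: left_factor_def inv)
  also have "(\<Sum>k<r. R i (Hilbert_Choice.inv \<tau> k) * (if k = j then 1 else 0)) = R i (Hilbert_Choice.inv \<tau> j)"
    using j by (subst sum.remove[of _ j]) auto
  finally show ?thesis .
qed

lemma right_factor_mult_left_factor:
  assumes \<tau>: "\<tau> permutes {..<r + m}" and j: "j < r"
  shows "(\<Sum>l<r + m. right_factor \<tau> r m c d E i l * left_factor \<tau> r c l j) = E i j"
  unfolding sum_mult_left_factor[OF assms] using j by (simp add: right_factor_def permutes_inverses(1)[OF \<tau>])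

lemma eq_right_factor:
  assumes \<tau>: "\<tau> permutes {..<r + m}"
    and E: "\<And>j. j < r \<Longrightarrow> E i j = (\<Sum>l<r + m. R i l * left_factor \<tau> r c l j)"
  shows "R i j = right_factor \<tau> r m c (\<lambda>i l. R i (Hilbert_Choice.inv \<tau> (r + l))) E i j"
  unfolding right_factor_def using E[of "\<tau> j"]
  by (auto simp: sum_mult_left_factor[OF \<tau>] permutes_inverses(2)[OF \<tau>])

text \<open>A maximal linearly independent set \<open>J\<close> of rows of \<open>M\<close> forms
  \<open>R\<close>, and every other row is a combination of these; \<open>\<tau>\<close> moves
  \<open>J\<close> to the front. Independence of the rows of \<open>R\<close> is recorded as a right
  cancellation law.\<close>

lemma rank_factorization:
  fixes M :: "'a :: field mat"
  assumes M: "M \<in> carrier_mat p q"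
  shows "\<exists>r \<tau> c R. r \<le> p \<and> \<tau> permutes {..<p} \<and> R \<in> carrier_mat r q \<and>
    M = fmat p r (left_factor \<tau> r c) * R \<and>
    (\<forall>m. \<forall>Z\<in>carrier_mat m r. Z * R = 0\<^sub>m m q \<longrightarrow> Z = 0\<^sub>m m r)"
proof -
  define indep where "indep J \<longleftrightarrow> J \<subseteq> {..<p} \<and>
    (\<forall>v. (\<forall>j<q. (\<Sum>i\<in>J. v i * M $$ (i, j)) = 0) \<longrightarrow> (\<forall>i\<in>J. v i = 0))" for J
  have "finite {J. indep J}"
    by (rule finite_subset[of _ "Pow {..<p}"]) (auto simp: indep_def)
  moreover have "{} \<in> {J. indep J}" by (simp add: indep_def)
  ultimately obtain J where J: "indep J" and max: "\<And>J'. indep J' \<Longrightarrow> J \<subseteq> J' \<Longrightarrow> J' = J"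
    using finite_has_maximal[of "{J. indep J}"] by blast
  have Jp: "J \<subseteq> {..<p}" and finJ: "finite J"
    using J by (auto simp: indep_def intro: finite_subset)
  have "\<exists>d. \<forall>j<q. M $$ (i, j) = (\<Sum>k\<in>J. d k * M $$ (k, j))" if i: "i < p" "i \<notin> J" for i
  proof -
    have "\<not> indep (insert i J)" using max[of "insert i J"] i by blast
    then obtain v k where v: "\<And>j. j < q \<Longrightarrow> (\<Sum>i\<in>insert i J. v i * M $$ (i, j)) = 0"
      and k: "k \<in> insert i J" "v k \<noteq> 0"
      using Jp i unfolding indep_def by auto
    have v': "v i * M $$ (i, j) + (\<Sum>k\<in>J. v k * M $$ (k, j)) = 0" if "j < q" for j
      using v[OF that] finJ i by simp
    have "v i \<noteq> 0"
    proof
      assume "v i = 0"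
      then have "\<forall>j<q. (\<Sum>k\<in>J. v k * M $$ (k, j)) = 0" using v' by simp
      then have "\<forall>k\<in>J. v k = 0" using J unfolding indep_def by blast
      then show False using k \<open>v i = 0\<close> by auto
    qed
    have "M $$ (i, j) = (\<Sum>k\<in>J. (- v k / v i) * M $$ (k, j))" if "j < q" for j
    proof -
      have "(\<Sum>k\<in>J. (- v k / v i) * M $$ (k, j)) = - (\<Sum>k\<in>J. v k * M $$ (k, j)) / v i"
        by (simp add: sum_divide_distrib sum_negf)
      also have "\<dots> = M $$ (i, j)"
        using v'[OF that] \<open>v i \<noteq> 0\<close> by (simp add: field_simps add_eq_0_iff)
      finally show ?thesis by simp
    qed
    then show ?thesis by (intro exI[of _ "\<lambda>k. - v k / v i"]) blast
  qed
  then obtain d where d: "\<And>i j. i < p \<Longrightarrow> i \<notin> J \<Longrightarrow> j < q \<Longrightarrow>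
      M $$ (i, j) = (\<Sum>k\<in>J. d i k * M $$ (k, j))"
    by metis
  define r where "r = card J"
  have rp: "r \<le> p" unfolding r_def using card_mono[OF _ Jp] by simp
  have "\<exists>g. bij_betw g J {..<r}" "\<exists>h. bij_betw h ({..<p} - J) {r..<p}"
    using finJ Jp by (auto intro!: finite_same_card_bij simp: r_def card_Diff_subset)
  then obtain g h where g: "bij_betw g J {..<r}" and h: "bij_betw h ({..<p} - J) {r..<p}" by blast
  define \<tau> where "\<tau> i = (if i \<in> J then g i else if i < p then h i else i)" for i
  have \<tau>J: "bij_betw \<tau> J {..<r}" using g by (rule bij_betw_cong[THEN iffD1, rotated]) (simp add: \<tau>_def)
  have \<tau>J': "bij_betw \<tau> ({..<p} - J) {r..<p}"
    using h by (rule bij_betw_cong[THEN iffD1, rotated]) (simp add: \<tau>_def)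
  have un: "J \<union> ({..<p} - J) = {..<p}" "{..<r} \<union> {r..<p} = {..<p}" using Jp rp by auto
  have "bij_betw \<tau> (J \<union> ({..<p} - J)) ({..<r} \<union> {r..<p})"
    by (rule bij_betw_combine[OF \<tau>J \<tau>J']) auto
  then have "bij_betw \<tau> {..<p} {..<p}" unfolding un .
  then have \<tau>: "\<tau> permutes {..<p}"
    by (rule bij_imp_permutes) (use Jp in \<open>auto simp: \<tau>_def\<close>)
  have \<tau>_less: "\<tau> i < r \<longleftrightarrow> i \<in> J" if "i < p" for i
    using bij_betw_apply[OF \<tau>J, of i] bij_betw_apply[OF \<tau>J', of i] that by (cases "i \<in> J") auto
  have \<tau>im: "\<tau> ` J = {..<r}" by (rule bij_betw_imp_surj_on[OF \<tau>J])
  have "Hilbert_Choice.inv \<tau> ` {..<r} = J"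
    unfolding \<tau>im[symmetric] by (simp add: image_image permutes_inverses(2)[OF \<tau>])
  then have inv\<tau>J: "bij_betw (Hilbert_Choice.inv \<tau>) {..<r} J"
    using permutes_inj[OF permutes_inv[OF \<tau>]] by (auto simp: bij_betw_def intro: inj_on_subset)
  define c where "c l m = d (Hilbert_Choice.inv \<tau> (r + l)) (Hilbert_Choice.inv \<tau> m)" for l m
  define R where "R = fmat r q (\<lambda>k j. M $$ (Hilbert_Choice.inv \<tau> k, j))"
  have "M = fmat p r (left_factor \<tau> r c) * R"
    unfolding R_def fmat_mult
  proof (rule eq_matI; simp)
    fix i j assume ij: "i < p" "j < q"
    show "M $$ (i, j) = (\<Sum>s<r. left_factor \<tau> r c i s * M $$ (Hilbert_Choice.inv \<tau> s, j))"
    proof (cases "i \<in> J")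
      case True
      then have "\<tau> i < r" using \<tau>_less ij by simp
      then have "(\<Sum>s<r. left_factor \<tau> r c i s * M $$ (Hilbert_Choice.inv \<tau> s, j)) = M $$ (Hilbert_Choice.inv \<tau> (\<tau> i), j)"
        unfolding left_factor_def by (subst sum.remove[of _ "\<tau> i"]) (auto intro: sum.neutral)
      then show ?thesis by (simp add: permutes_inverses(2)[OF \<tau>])
    next
      case False
      then have "\<not> \<tau> i < r" using \<tau>_less ij by simp
      then have "(\<Sum>s<r. left_factor \<tau> r c i s * M $$ (Hilbert_Choice.inv \<tau> s, j)) =
          (\<Sum>s<r. d i (Hilbert_Choice.inv \<tau> s) * M $$ (Hilbert_Choice.inv \<tau> s, j))"
        unfolding left_factor_def c_def by (simp add: permutes_inverses(2)[OF \<tau>])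
      also have "\<dots> = (\<Sum>k\<in>J. d i k * M $$ (k, j))"
        by (rule sum.reindex_bij_betw[OF inv\<tau>J])
      finally show ?thesis using d[OF ij(1) False ij(2)] by simp
    qed
  qed (use M in auto)
  moreover have "Z = 0\<^sub>m m r" if Z: "Z \<in> carrier_mat m r" and 0: "Z * R = 0\<^sub>m m q" for m Z
  proof (rule eq_matI; simp)
    fix a k assume ak: "a < m" "k < r"
    define v where "v i = Z $$ (a, \<tau> i)" for i
    have "(\<Sum>i\<in>J. v i * M $$ (i, j)) = 0" if j: "j < q" for j
    proof -
      have "(\<Sum>i\<in>J. v i * M $$ (i, j)) = (\<Sum>s<r. v (Hilbert_Choice.inv \<tau> s) * M $$ (Hilbert_Choice.inv \<tau> s, j))"
        by (rule sum.reindex_bij_betw[OF inv\<tau>J, symmetric])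
      also have "\<dots> = (Z * R) $$ (a, j)"
        using ak j Z unfolding v_def R_def
        by (simp add: permutes_inverses(1)[OF \<tau>] scalar_prod_def lessThan_atLeast0)
      finally show ?thesis using 0 ak j by simp
    qed
    then have "\<forall>i\<in>J. v i = 0" using J unfolding indep_def by blast
    moreover have "Hilbert_Choice.inv \<tau> k \<in> J" using inv\<tau>J ak(2) unfolding bij_betw_def by auto
    ultimately show "Z $$ (a, k) = 0"
      unfolding v_def using permutes_inverses(1)[OF \<tau>, of k] by force
  qed (use Z in auto)
  ultimately show ?thesis
    using rp \<tau> by (intro exI[of _ r] exI[of _ \<tau>] exI[of _ c] exI[of _ R]) (auto simp: R_def)
qed

text \<open>Here \<open>E\<close> is \<open>R * C\<close>, and \<open>d\<close> collects the columns
  of \<open>R\<close> that \<open>\<tau>\<close> sends to \<open>r\<close> and beyond.\<close>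

lemma chart_factorization:
  fixes M :: "'a :: field mat"
  assumes M: "M \<in> carrier_mat p p"
  shows "\<exists>r \<tau> c d E. r \<le> p \<and> \<tau> permutes {..<p} \<and>
    M = fmat p r (left_factor \<tau> r c) * fmat r p (right_factor \<tau> r (p - r) c d E) \<and>
    (\<forall>m. \<forall>Z\<in>carrier_mat m r. Z * fmat r p (right_factor \<tau> r (p - r) c d E) = 0\<^sub>m m p \<longrightarrow> Z = 0\<^sub>m m r)"
proof -
  obtain r \<tau> c R where r: "r \<le> p" and \<tau>: "\<tau> permutes {..<p}" and R: "R \<in> carrier_mat r p"
    and MCR: "M = fmat p r (left_factor \<tau> r c) * R"
    and ker: "\<forall>m. \<forall>Z\<in>carrier_mat m r. Z * R = 0\<^sub>m m p \<longrightarrow> Z = 0\<^sub>m m r"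
    using rank_factorization[OF M] by blast
  define E where "E i j = (\<Sum>l<p. R $$ (i, l) * left_factor \<tau> r c l j)" for i j
  define d where "d i l = R $$ (i, Hilbert_Choice.inv \<tau> (r + l))" for i l
  have "R = fmat r p (right_factor \<tau> r (p - r) c d E)"
    unfolding d_def
  proof (subst fmat_entries[OF R, symmetric], rule fmat_cong)
    fix i j
    show "R $$ (i, j) = right_factor \<tau> r (p - r) c (\<lambda>i l. R $$ (i, Hilbert_Choice.inv \<tau> (r + l))) E i j"
      by (rule eq_right_factor[where R = "\<lambda>i j. R $$ (i, j)"]) (use r \<tau> in \<open>auto simp: E_def\<close>)
  qed
  then show ?thesis using r \<tau> MCR ker by metis
qed

lemma right_factor_mult_left_factor_mat:
  assumes \<tau>: "\<tau> permutes {..<p}" and r: "r \<le> p"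
  shows "fmat r p (right_factor \<tau> r (p - r) c d E) * fmat p r (left_factor \<tau> r c) = fmat r r E"
  unfolding fmat_mult by (rule fmat_cong) (use right_factor_mult_left_factor[of \<tau> r "p - r"] assms in auto)

text \<open>Side conditions on dimensions can be discharged by simplification, without guessing
  carriers.\<close>

lemma assoc_mult_mat_dim:
  fixes A B C :: "'a :: semiring_0 mat"
  assumes "dim_col A = dim_row B" "dim_col B = dim_row C"
  shows "A * B * C = A * (B * C)"
  using assms
  by (intro assoc_mult_mat[of A "dim_row A" "dim_col A" B "dim_col B" C "dim_col C"]) auto

section \<open>Charts for the matrices with \<open>P\<^sup>3 = P\<^sup>2\<close>\<close>

abbreviation delta :: "nat \<Rightarrow> nat \<Rightarrow> 'a :: zero_neq_one" where
  "delta i j \<equiv> if i = j then 1 else 0"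

text \<open>If \<open>P ^ 3 = P ^ 2\<close> and \<open>P = C * R\<close> is a factorization of full rank \<open>r\<close>, then \<open>E = R * C\<close> is
  idempotent, so it factors in turn as \<open>C' * R'\<close> with \<open>R' * C' = 1\<close>. The parameters \<open>x 0\<close>, \<open>x 1\<close>
  belong to the outer factorization, \<open>x 2\<close>, \<open>x 3\<close> to the inner one. The matrices \<open>C * C'\<close> and
  \<open>R' * R\<close> span the columns and the rows of \<open>P ^ 2\<close>.\<close>

definition inner_right :: "nat \<Rightarrow> nat \<Rightarrow> (nat \<Rightarrow> nat) \<Rightarrow> (nat \<Rightarrow> nat \<Rightarrow> nat \<Rightarrow> 'a :: field) \<Rightarrow> nat \<Rightarrow> nat \<Rightarrow> 'a" where
  "inner_right r a \<tau>' x = right_factor \<tau>' a (r - a) (x 2) (x 3) delta"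

definition idempotent_block :: "nat \<Rightarrow> nat \<Rightarrow> (nat \<Rightarrow> nat) \<Rightarrow> (nat \<Rightarrow> nat \<Rightarrow> nat \<Rightarrow> 'a :: field) \<Rightarrow> nat \<Rightarrow> nat \<Rightarrow> 'a" where
  "idempotent_block r a \<tau>' x i j = (\<Sum>l<a. left_factor \<tau>' a (x 2) i l * inner_right r a \<tau>' x l j)"

definition outer_right where
  "outer_right p r a \<tau> \<tau>' x = right_factor \<tau> r (p - r) (x 0) (x 1) (idempotent_block r a \<tau>' x)"

definition chart_block where
  "chart_block p r a \<tau> \<tau>' x i j = (\<Sum>l<r. left_factor \<tau> r (x 0) i l * outer_right p r a \<tau> \<tau>' x l j)"

definition chart_left where
  "chart_left r a \<tau> \<tau>' x i k = (\<Sum>l<r. left_factor \<tau> r (x 0) i l * left_factor \<tau>' a (x 2) l k)"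

definition chart_right where
  "chart_right p r a \<tau> \<tau>' x k j = (\<Sum>l<r. inner_right r a \<tau>' x k l * outer_right p r a \<tau> \<tau>' x l j)"

text \<open>Everything follows from \<open>R * C = C' * R'\<close> and \<open>R' * C' = 1\<close>:
  \<open>P * P\<close> is \<open>C * (R * C) * R\<close>, and in \<open>P * U\<close> and
  \<open>W * P\<close> the inner factors cancel.\<close>

lemma chart_relations:
  fixes x :: "nat \<Rightarrow> nat \<Rightarrow> nat \<Rightarrow> 'a :: field"
  assumes r: "r \<le> p" and a: "a \<le> r" and \<tau>: "\<tau> permutes {..<p}" and \<tau>': "\<tau>' permutes {..<r}"
    and P: "P = fmat p p (chart_block p r a \<tau> \<tau>' x)" and U: "U = fmat p a (chart_left r a \<tau> \<tau>' x)"
    and W: "W = fmat a p (chart_right p r a \<tau> \<tau>' x)"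
  shows "P * P = U * W" "P * U = U" "W * P = W" "P * P * P = P * P"
proof -
  let ?C = "fmat p r (left_factor \<tau> r (x 0))" and ?R = "fmat r p (outer_right p r a \<tau> \<tau>' x)"
  let ?C' = "fmat r a (left_factor \<tau>' a (x 2))" and ?R' = "fmat a r (inner_right r a \<tau>' x)"
  have P': "P = ?C * ?R" and U': "U = ?C * ?C'" and W': "W = ?R' * ?R"
    unfolding P U W fmat_mult chart_block_def chart_left_def chart_right_def by simp_all
  have "?R * ?C = fmat r r (idempotent_block r a \<tau>' x)"
    unfolding outer_right_def by (rule right_factor_mult_left_factor_mat[OF \<tau> r])
  also have "\<dots> = ?C' * ?R'"
    unfolding fmat_mult by (rule fmat_cong) (simp add: idempotent_block_def)
  finally have RC: "?R * ?C = ?C' * ?R'" .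
  have RC': "?R' * ?C' = 1\<^sub>m a"
    unfolding inner_right_def right_factor_mult_left_factor_mat[OF \<tau>' a] fmat_one ..
  have RCZ: "?R * (?C * Z) = ?C' * (?R' * Z)" if "dim_row Z = r" for Z
    using that RC by (simp flip: assoc_mult_mat_dim)
  have RCZ': "?R' * (?C' * Z) = Z" if "dim_row Z = a" for Z
    using that RC' left_mult_one_mat[of Z a "dim_col Z"] by (simp flip: assoc_mult_mat_dim)
  show PP: "P * P = U * W"
    unfolding P' U' W' by (simp add: assoc_mult_mat_dim RCZ)
  show PU: "P * U = U"
    unfolding P' U' by (simp add: assoc_mult_mat_dim RCZ RC')
  show "W * P = W"
    unfolding P' W' by (simp add: assoc_mult_mat_dim RCZ RCZ')
  have "P * P * P = P * (P * P)" by (rule assoc_mult_mat_dim) (simp_all add: P)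
  also have "\<dots> = (P * U) * W" unfolding PP by (rule assoc_mult_mat_dim[symmetric]) (simp_all add: P U W)
  finally show "P * P * P = P * P" unfolding PU PP .
qed

text \<open>Cancelling \<open>C\<close> on the left and \<open>R\<close> on the right in
  \<open>C * E\<^sup>2 * R = C * E * R\<close> makes \<open>E\<close> idempotent; the same
  cancellation for a factorization of \<open>E\<close> gives \<open>E' = 1\<close>.\<close>

lemma chart_cover:
  fixes P :: "'a :: field mat"
  assumes P: "P \<in> carrier_mat p p" and PPP: "P * P * P = P * P"
  shows "\<exists>r a \<tau> \<tau>' x. r \<le> p \<and> a \<le> r \<and> \<tau> permutes {..<p} \<and> \<tau>' permutes {..<r} \<and>
    P = fmat p p (chart_block p r a \<tau> \<tau>' x)"
proof -
  obtain r \<tau> c d E where r: "r \<le> p" and \<tau>: "\<tau> permutes {..<p}"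
    and PCR: "P = fmat p r (left_factor \<tau> r c) * fmat r p (right_factor \<tau> r (p - r) c d E)"
    and ker: "\<And>m Z. Z \<in> carrier_mat m r \<Longrightarrow>
      Z * fmat r p (right_factor \<tau> r (p - r) c d E) = 0\<^sub>m m p \<Longrightarrow> Z = 0\<^sub>m m r"
    using chart_factorization[OF P] by blast
  let ?C = "fmat p r (left_factor \<tau> r c)" and ?R = "fmat r p (right_factor \<tau> r (p - r) c d E)" and ?E = "fmat r r E"
  have RC: "?R * ?C = ?E" by (rule right_factor_mult_left_factor_mat[OF \<tau> r])
  have RCZ: "?R * (?C * Z) = ?E * Z" if "dim_row Z = r" for Z
    using that RC by (simp flip: assoc_mult_mat_dim)
  have CEER: "?C * (?E * (?E * ?R)) = ?C * (?E * ?R)"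
    using PPP unfolding PCR by (simp add: assoc_mult_mat_dim RCZ)
  \<comment> \<open>A left inverse of \<open>C\<close> is a right factor for the same
    \<open>\<tau>\<close> and \<open>c\<close>, with free columns \<open>0\<close> and prescribed
    product \<open>delta\<close>.\<close>
  have left: "\<exists>L\<in>carrier_mat r p. L * ?C = 1\<^sub>m r"
  proof -
    have "fmat r p (right_factor \<tau> r (p - r) c (\<lambda>_ _. 0) delta) * ?C = 1\<^sub>m r"
      unfolding right_factor_mult_left_factor_mat[OF \<tau> r] fmat_one ..
    then show ?thesis using fmat_carrier by blast
  qed
  then obtain L where L: "L \<in> carrier_mat r p" "L * ?C = 1\<^sub>m r" by blast
  have LCZ: "L * (?C * Z) = Z" if "dim_row Z = r" for Z
    using that L left_mult_one_mat[of Z r "dim_col Z"] by (simp flip: assoc_mult_mat_dim)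
  have "L * (?C * (?E * (?E * ?R))) = L * (?C * (?E * ?R))"
    unfolding CEER ..
  then have "?E * (?E * ?R) = ?E * ?R" by (simp add: LCZ)
  then have "(?E * ?E - ?E) * ?R = 0\<^sub>m r p"
    using minus_mult_distrib_mat[of "?E * ?E" r r ?E ?R p]
      minus_r_inv_mat[of "?E * ?R" r p] mult_carrier_mat[of ?E r r ?R p]
    by (simp add: assoc_mult_mat_dim)
  then have "?E * ?E - ?E = 0\<^sub>m r r" by (intro ker) auto
  then have EE: "?E * ?E = ?E" using diff_mat_eq_0_iff[of "?E * ?E" r r ?E] by simp
  obtain a \<tau>' c' d' E' where a: "a \<le> r" and \<tau>': "\<tau>' permutes {..<r}"
    and ECR: "?E = fmat r a (left_factor \<tau>' a c') * fmat a r (right_factor \<tau>' a (r - a) c' d' E')"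
    and ker': "\<And>m Z. Z \<in> carrier_mat m a \<Longrightarrow>
      Z * fmat a r (right_factor \<tau>' a (r - a) c' d' E') = 0\<^sub>m m r \<Longrightarrow> Z = 0\<^sub>m m a"
    using chart_factorization[of ?E r] by auto
  let ?C' = "fmat r a (left_factor \<tau>' a c')" and ?R' = "fmat a r (right_factor \<tau>' a (r - a) c' d' E')"
    and ?E' = "fmat a a E'"
  have RC': "?R' * ?C' = ?E'" by (rule right_factor_mult_left_factor_mat[OF \<tau>' a])
  have RCZ': "?R' * (?C' * Z) = ?E' * Z" if "dim_row Z = a" for Z
    using that RC' by (simp flip: assoc_mult_mat_dim)
  have left': "\<exists>L\<in>carrier_mat a r. L * ?C' = 1\<^sub>m a"
  proof -
    have "fmat a r (right_factor \<tau>' a (r - a) c' (\<lambda>_ _. 0) delta) * ?C' = 1\<^sub>m a"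
      unfolding right_factor_mult_left_factor_mat[OF \<tau>' a] fmat_one ..
    then show ?thesis using fmat_carrier by blast
  qed
  then obtain L' where L': "L' \<in> carrier_mat a r" "L' * ?C' = 1\<^sub>m a" by blast
  have LCZ': "L' * (?C' * Z) = Z" if "dim_row Z = a" for Z
    using that L' left_mult_one_mat[of Z a "dim_col Z"] by (simp flip: assoc_mult_mat_dim)
  have "?C' * (?E' * ?R') = ?C' * ?R'"
    using EE unfolding ECR by (simp add: assoc_mult_mat_dim RCZ')
  then have "L' * (?C' * (?E' * ?R')) = L' * (?C' * ?R')" by simp
  then have "?E' * ?R' = ?R'" by (simp add: LCZ')
  then have "(?E' - 1\<^sub>m a) * ?R' = 0\<^sub>m a r"
    using minus_mult_distrib_mat[of ?E' a a "1\<^sub>m a" ?R' r]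
      minus_r_inv_mat[of ?R' a r] left_mult_one_mat[of ?R' a r]
    by simp
  then have "?E' - 1\<^sub>m a = 0\<^sub>m a a" by (intro ker') auto
  then have E1: "?E' = 1\<^sub>m a" using diff_mat_eq_0_iff[of ?E' a a "1\<^sub>m a"] by simp
  define x :: "nat \<Rightarrow> nat \<Rightarrow> nat \<Rightarrow> 'a" where
    "x t = (if t = 0 then c else if t = 1 then d else if t = 2 then c' else d')" for t
  have x: "x 0 = c" "x 1 = d" "x 2 = c'" "x 3 = d'" unfolding x_def by simp_all
  have E'd: "E' i j = delta i j" if "i < a" "j < a" for i j
    using arg_cong[OF E1, of "\<lambda>M. M $$ (i, j)"] that by simp
  \<comment> \<open>A right factor consults \<open>E\<close> only at column indices below the rank,
    so agreement of entries in range is enough.\<close>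
  have R'x: "?R' = fmat a r (inner_right r a \<tau>' x)"
    unfolding inner_right_def x by (rule fmat_cong) (auto simp: right_factor_def E'd)
  have "?E = fmat r r (idempotent_block r a \<tau>' x)"
    unfolding ECR R'x unfolding fmat_mult idempotent_block_def x by simp
  then have "fmat r r E $$ (i, j) = fmat r r (idempotent_block r a \<tau>' x) $$ (i, j)" for i j by simp
  then have Ex: "E i j = idempotent_block r a \<tau>' x i j" if "i < r" "j < r" for i j using that by (metis fmat_index)
  have Rx: "?R = fmat r p (outer_right p r a \<tau> \<tau>' x)"
    unfolding outer_right_def x by (rule fmat_cong) (auto simp: right_factor_def Ex)
  have "P = fmat p p (chart_block p r a \<tau> \<tau>' x)"
    unfolding PCR Rx unfolding fmat_mult chart_block_def x by simp
  then show ?thesis using r a \<tau> \<tau>' by blast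
qed

lemma polyf_left_factor:
  assumes "\<tau> permutes {..<p}" "i < p" "\<And>k. k < p - r \<Longrightarrow> polyf I (\<lambda>z. c z k j)"
  shows "polyf I (\<lambda>z. left_factor \<tau> r (c z) i j)"
proof -
  have "\<tau> i < p" using permutes_in_image[OF assms(1), of i] assms(2) by simp
  then show ?thesis
    unfolding left_factor_def using assms(3)[of "\<tau> i - r"]
    by (cases "\<tau> i < r") (auto intro: polyf.const)
qed

lemma polyf_right_factor:
  assumes "\<tau> permutes {..<p}" "j < p" "\<And>k. k < p - r \<Longrightarrow> polyf I (\<lambda>z. d z i k)"
    "\<And>k l. k < p - r \<Longrightarrow> l < r \<Longrightarrow> polyf I (\<lambda>z. c z k l)" "\<And>l. l < r \<Longrightarrow> polyf I (\<lambda>z. E z i l)"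
  shows "polyf I (\<lambda>z. right_factor \<tau> r (p - r) (c z) (d z) (E z) i j)"
proof -
  have "\<tau> j < p" using permutes_in_image[OF assms(1), of j] assms(2) by simp
  then show ?thesis
    unfolding right_factor_def using assms(3)[of "\<tau> j - r"]
    by (cases "\<tau> j < r") (auto intro!: polyf_diff polyf_sum polyf.mult assms(3-5))
qed

lemma polyf_chart:
  assumes r: "r \<le> p" and a: "a \<le> r" and \<tau>: "\<tau> permutes {..<p}" and \<tau>': "\<tau>' permutes {..<r}"
    and x: "\<And>i j. i < p - r \<Longrightarrow> j < r \<Longrightarrow> polyf I (\<lambda>z. x z 0 i j)"
      "\<And>i j. i < r \<Longrightarrow> j < p - r \<Longrightarrow> polyf I (\<lambda>z. x z 1 i j)"
      "\<And>i j. i < r - a \<Longrightarrow> j < a \<Longrightarrow> polyf I (\<lambda>z. x z 2 i j)"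
      "\<And>i j. i < a \<Longrightarrow> j < r - a \<Longrightarrow> polyf I (\<lambda>z. x z 3 i j)"
  shows "i < p \<Longrightarrow> j < p \<Longrightarrow> polyf I (\<lambda>z. chart_block p r a \<tau> \<tau>' (x z) i j)"
    and "i < p \<Longrightarrow> k < a \<Longrightarrow> polyf I (\<lambda>z. chart_left r a \<tau> \<tau>' (x z) i k)"
    and "k < a \<Longrightarrow> j < p \<Longrightarrow> polyf I (\<lambda>z. chart_right p r a \<tau> \<tau>' (x z) k j)"
proof -
  have R': "polyf I (\<lambda>z. inner_right r a \<tau>' (x z) i j)" if "i < a" "j < r" for i j
    unfolding inner_right_def using that by (intro polyf_right_factor[OF \<tau>'] x polyf.const)
  have E: "polyf I (\<lambda>z. idempotent_block r a \<tau>' (x z) i j)" if "i < r" "j < r" for i j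
    unfolding idempotent_block_def using that by (intro polyf_sum polyf.mult polyf_left_factor[OF \<tau>'] x R') auto
  have R: "polyf I (\<lambda>z. outer_right p r a \<tau> \<tau>' (x z) i j)" if "i < r" "j < p" for i j
    unfolding outer_right_def using that by (intro polyf_right_factor[OF \<tau>] x E)
  show "polyf I (\<lambda>z. chart_block p r a \<tau> \<tau>' (x z) i j)" if "i < p" "j < p"
    unfolding chart_block_def using that by (intro polyf_sum polyf.mult polyf_left_factor[OF \<tau>] x R) auto
  show "polyf I (\<lambda>z. chart_left r a \<tau> \<tau>' (x z) i k)" if "i < p" "k < a"
    unfolding chart_left_def using that by (intro polyf_sum polyf.mult polyf_left_factor[OF \<tau>] polyf_left_factor[OF \<tau>'] x) auto
  show "polyf I (\<lambda>z. chart_right p r a \<tau> \<tau>' (x z) k j)" if "k < a" "j < p"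
    unfolding chart_right_def using that by (intro polyf_sum polyf.mult R R') auto
qed

text \<open>Order of vanishing at the origin, tested on lines through it. Working modulo
  \<open>ord_ge 2\<close> replaces the computation of differentials.\<close>

definition ord_ge :: "nat \<Rightarrow> (('i \<Rightarrow> 'a :: field) \<Rightarrow> 'a) \<Rightarrow> bool" where
  "ord_ge k F \<longleftrightarrow> (\<forall>z. \<exists>h. \<forall>t. F (\<lambda>i. t * z i) = t ^ k * poly h t)"

lemma ord_ge_const: "ord_ge 0 (\<lambda>z. c)"
  unfolding ord_ge_def by (intro allI exI[of _ "[:c:]"]) simp

lemma ord_ge_0: "ord_ge k (\<lambda>z. 0)"
  unfolding ord_ge_def by (intro allI exI[of _ 0]) simp

lemma ord_ge_coord: "ord_ge 1 (\<lambda>z. z i)"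
  unfolding ord_ge_def by (rule allI, rule_tac x = "[:z i:]" in exI) simp

lemma ord_ge_add:
  assumes "ord_ge k F" "ord_ge k G"
  shows "ord_ge k (\<lambda>z. F z + G z)"
  unfolding ord_ge_def
proof
  fix z
  obtain f g where "\<forall>t. F (\<lambda>i. t * z i) = t ^ k * poly f t" "\<forall>t. G (\<lambda>i. t * z i) = t ^ k * poly g t"
    using assms unfolding ord_ge_def by metis
  then show "\<exists>h. \<forall>t. F (\<lambda>i. t * z i) + G (\<lambda>i. t * z i) = t ^ k * poly h t"
    by (intro exI[of _ "f + g"]) (simp add: distrib_left)
qed

lemma ord_ge_mult:
  assumes "ord_ge k F" "ord_ge l G"
  shows "ord_ge (k + l) (\<lambda>z. F z * G z)"
  unfolding ord_ge_def
proof
  fix z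
  obtain f g where "\<forall>t. F (\<lambda>i. t * z i) = t ^ k * poly f t" "\<forall>t. G (\<lambda>i. t * z i) = t ^ l * poly g t"
    using assms unfolding ord_ge_def by metis
  then show "\<exists>h. \<forall>t. F (\<lambda>i. t * z i) * G (\<lambda>i. t * z i) = t ^ (k + l) * poly h t"
    by (intro exI[of _ "f * g"]) (simp add: power_add)
qed

lemma ord_ge_uminus: "ord_ge k F \<Longrightarrow> ord_ge k (\<lambda>z. - F z)"
  using ord_ge_mult[OF ord_ge_const[of "-1"], of k F] by simp

lemma ord_ge_diff: "ord_ge k F \<Longrightarrow> ord_ge k G \<Longrightarrow> ord_ge k (\<lambda>z. F z - G z)"
  using ord_ge_add[of k F "\<lambda>z. - G z"] ord_ge_uminus[of k G] by simp

lemma ord_ge_sum: "(\<And>s. s \<in> S \<Longrightarrow> ord_ge k (F s)) \<Longrightarrow> ord_ge k (\<lambda>z. \<Sum>s\<in>S. F s z)"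
  by (induction S rule: infinite_finite_induct) (auto intro: ord_ge_0 ord_ge_add)

lemma ord_ge_weaken:
  assumes "ord_ge l F" "k \<le> l"
  shows "ord_ge k F"
  unfolding ord_ge_def
proof
  fix z
  obtain f where "\<forall>t. F (\<lambda>i. t * z i) = t ^ l * poly f t" using assms unfolding ord_ge_def by metis
  then show "\<exists>h. \<forall>t. F (\<lambda>i. t * z i) = t ^ k * poly h t"
    using assms(2) by (intro exI[of _ "monom 1 (l - k) * f"]) (simp add: poly_monom flip: power_add mult.assoc)
qed

lemma ord_ge_1_1: "ord_ge 1 F \<Longrightarrow> ord_ge 1 G \<Longrightarrow> ord_ge 2 (\<lambda>z. F z * G z)"
  using ord_ge_mult[of 1 F 1 G] by (simp add: numeral_2_eq_2)

text \<open>Replacing \<open>R\<close> by its constant term, a unit vector, changes the sum only by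
  products of two factors of order one. Linear terms of matrix products are read off this
  way.\<close>

lemma ord_ge_sum_mult:
  fixes n k :: nat
  assumes c: "\<And>l. l < n \<Longrightarrow> ord_ge 1 (\<lambda>z. c z l)"
    and R: "\<And>l. l < n \<Longrightarrow> ord_ge 1 (\<lambda>z. R z l - (if l = k then 1 else 0))" and k: "k < n"
  shows "ord_ge 2 (\<lambda>z. (\<Sum>l<n. c z l * R z l) - c z k)"
proof -
  have "(\<Sum>l<n. c z l * R z l) - c z k = (\<Sum>l<n. c z l * (R z l - (if l = k then 1 else 0)))" for z
  proof -
    have "(\<Sum>l<n. c z l * (if l = k then 1 else 0)) = c z k"
      using k by (subst sum.remove[of _ k]) auto
    then show ?thesis by (simp add: right_diff_distrib sum_subtractf)
  qed
  then show ?thesis using c R by (auto intro!: ord_ge_sum ord_ge_1_1)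
qed

text \<open>The base point has \<open>x 1\<close> equal to a partial identity and all other parameters \<open>0\<close>. There \<open>R\<close> has
  full rank \<open>r\<close>, which is what allows \<open>x 0\<close> to be read off to first order although \<open>E\<close> is singular.\<close>

lemma chart_jet:
  fixes x :: "('i \<Rightarrow> 'a :: field) \<Rightarrow> nat \<Rightarrow> nat \<Rightarrow> nat \<Rightarrow> 'a"
  assumes r: "r \<le> p" and a: "a \<le> r" and k: "r - a \<le> p - r"
    and x0: "\<And>i j. ord_ge 1 (\<lambda>z. x z 0 i j)"
    and x1: "\<And>i j. ord_ge 1 (\<lambda>z. x z 1 i j - (if i = a + j then 1 else 0))"
    and x2: "\<And>i j. ord_ge 1 (\<lambda>z. x z 2 i j)"
    and x3: "\<And>i j. ord_ge 1 (\<lambda>z. x z 3 i j)"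
  defines "P \<equiv> \<lambda>z. chart_block p r a id id (x z)" and "W \<equiv> \<lambda>z. chart_right p r a id id (x z)"
  shows "i < p - r \<Longrightarrow> j < a \<Longrightarrow> ord_ge 2 (\<lambda>z. P z (r + i) j - x z 0 i j)"
    and "i < p - r \<Longrightarrow> a \<le> j \<Longrightarrow> j < r \<Longrightarrow> ord_ge 2 (\<lambda>z. P z (r + i) (r + (j - a)) - x z 0 i j)"
    and "i < r \<Longrightarrow> P z i (r + j) = x z 1 i j"
    and "i < r - a \<Longrightarrow> j < a \<Longrightarrow> ord_ge 2 (\<lambda>z. P z (a + i) j + P z (r + i) j - x z 2 i j)"
    and "i < a \<Longrightarrow> j < r - a \<Longrightarrow> ord_ge 2 (\<lambda>z. P z i (a + j) - x z 3 i j)"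
    and "i < a \<Longrightarrow> j < a \<Longrightarrow> ord_ge 1 (\<lambda>z. W z i j - (if i = j then 1 else 0))"
proof -
  define R' where "R' z = inner_right r a id (x z)" for z
  define E where "E z = idempotent_block r a id (x z)" for z
  define R where "R z = outer_right p r a id id (x z)" for z
  have id_sum: "(\<Sum>l<n. (if i = l then 1 else 0) * f l) = f i" if "i < n" for i n :: nat and f :: "nat \<Rightarrow> 'a"
    using that by (subst sum.remove[of _ i]) auto
  have R'1: "ord_ge 1 (\<lambda>z. R' z i j - (if i = j then 1 else 0))" if "i < a" for i j
  proof (cases "j < a")
    case True
    then have "R' z i j - (if i = j then 1 else 0) = - (\<Sum>l<r - a. x z 3 i l * x z 2 l j)" for z
      unfolding R'_def inner_right_def right_factor_def by simp
    moreover have "ord_ge 2 (\<lambda>z. - (\<Sum>l<r - a. x z 3 i l * x z 2 l j))"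
      by (intro ord_ge_uminus ord_ge_sum ord_ge_1_1 x2 x3)
    ultimately show ?thesis using ord_ge_weaken[of 2 _ 1] by simp
  next
    case False
    then show ?thesis using that x3 unfolding R'_def inner_right_def right_factor_def by simp
  qed
  have E_top: "E z i j = R' z i j" if "i < a" for z i j
    using that id_sum[OF that, of "\<lambda>l. R' z l j"] unfolding E_def idempotent_block_def R'_def left_factor_def by simp
  have E_bottom: "E z i j = (\<Sum>l<a. x z 2 (i - a) l * R' z l j)" if "a \<le> i" for z i j
    using that unfolding E_def idempotent_block_def R'_def left_factor_def by simp
  have E2: "ord_ge 2 (\<lambda>z. E z i j - x z 2 (i - a) j)" if "a \<le> i" "j < a" for i j
    unfolding E_bottom[OF that(1)] by (intro ord_ge_sum_mult x2 R'1 that)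
  have E2': "ord_ge 2 (\<lambda>z. E z i j)" if "a \<le> i" "a \<le> j" for i j
    unfolding E_bottom[OF that(1)]
  proof (intro ord_ge_sum ord_ge_1_1 x2)
    fix l assume "l \<in> {..<a}"
    then show "ord_ge 1 (\<lambda>z. R' z l j)" using R'1[of l j] that(2) by simp
  qed
  have E1: "ord_ge 1 (\<lambda>z. E z i j - (if i = j \<and> j < a then 1 else 0))" for i j
  proof (cases "i < a")
    case True
    then show ?thesis using R'1[of i j] E_top[of i _ j] by (cases "j < a") auto
  next
    case i: False
    show ?thesis
    proof (cases "j < a")
      case True
      have "ord_ge 1 (\<lambda>z. (E z i j - x z 2 (i - a) j) + x z 2 (i - a) j)"
        using i True by (intro ord_ge_add x2 ord_ge_weaken[OF E2, of _ _ 1]) auto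
      then show ?thesis using i True by simp
    next
      case False
      then show ?thesis using i ord_ge_weaken[OF E2'[of i j], of 1] by simp
    qed
  qed
  have R_left: "R z i j = E z i j - (\<Sum>l<p - r. x z 1 i l * x z 0 l j)" if "j < r" for z i j
    using that unfolding R_def outer_right_def right_factor_def E_def by simp
  have R_right: "R z i (r + j) = x z 1 i j" for z i j
    unfolding R_def outer_right_def right_factor_def by simp
  \<comment> \<open>Rows of \<open>x 1\<close> above row \<open>a\<close> have no constant term,
    because \<open>i = a + l\<close> fails for \<open>i < a\<close>.\<close>
  have Rtop: "ord_ge 2 (\<lambda>z. R z i j - E z i j)" if "i < a" "j < r" for i j
  proof -
    have "ord_ge 1 (\<lambda>z. x z 1 i l)" for l using x1[of i l] that by simp
    then have "ord_ge 2 (\<lambda>z. - (\<Sum>l<p - r. x z 1 i l * x z 0 l j))"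
      by (intro ord_ge_uminus ord_ge_sum ord_ge_1_1 x0)
    then show ?thesis unfolding R_left[OF that(2)] by simp
  qed
  \<comment> \<open>Row \<open>i \<ge> a\<close> of \<open>x 1\<close> has its constant
    \<open>1\<close> in column \<open>i - a\<close>, which exists by
    \<open>r - a \<le> p - r\<close>; hence \<open>x 0\<close> enters linearly, with a minus
    sign.\<close>
  have Rbottom: "ord_ge 2 (\<lambda>z. R z i j - E z i j + x z 0 (i - a) j)" if "a \<le> i" "i < r" "j < r" for i j
  proof -
    have "ord_ge 1 (\<lambda>z. x z 1 i l - (if l = i - a then 1 else 0))" for l
    proof -
      have "i = a + l \<longleftrightarrow> l = i - a" using that by auto
      then show ?thesis using x1[of i l] by simp
    qed
    then have "ord_ge 2 (\<lambda>z. (\<Sum>l<p - r. x z 0 l j * x z 1 i l) - x z 0 (i - a) j)"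
      by (intro ord_ge_sum_mult x0) (use that k in auto)
    from ord_ge_uminus[OF this] show ?thesis
      unfolding R_left[OF that(3)] by (simp add: mult.commute)
  qed
  have R1: "ord_ge 1 (\<lambda>z. R z i j - (if i = j \<and> j < a then 1 else 0))" if "i < r" "j < r" for i j
  proof (cases "i < a")
    case True
    have "ord_ge 1 (\<lambda>z. (R z i j - E z i j) + (E z i j - (if i = j \<and> j < a then 1 else 0)))"
      using True that by (intro ord_ge_add E1 ord_ge_weaken[OF Rtop, of _ _ 1]) auto
    then show ?thesis by simp
  next
    case False
    have "ord_ge 1 (\<lambda>z. (R z i j - E z i j + x z 0 (i - a) j) +
        (E z i j - (if i = j \<and> j < a then 1 else 0)) - x z 0 (i - a) j)"
      using False that by (intro ord_ge_diff ord_ge_add E1 x0 ord_ge_weaken[OF Rbottom, of _ _ 1]) auto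
    then show ?thesis by simp
  qed
  have P_top: "P z i j = R z i j" if "i < r" for z i j
    using that id_sum[OF that, of "\<lambda>l. R z l j"] unfolding P_def chart_block_def R_def left_factor_def by simp
  have P_bottom: "P z (r + i) j = (\<Sum>l<r. x z 0 i l * R z l j)" for z i j
    unfolding P_def chart_block_def R_def left_factor_def by simp
  have J0: "ord_ge 2 (\<lambda>z. P z (r + i) j - x z 0 i j)" if "j < a" for i j
    unfolding P_bottom
  proof (intro ord_ge_sum_mult x0)
    show "ord_ge 1 (\<lambda>z. R z l j - (if l = j then 1 else 0))" if "l < r" for l
      using R1[of l j] that \<open>j < a\<close> a by simp
  qed (use that a in simp)
  then show "ord_ge 2 (\<lambda>z. P z (r + i) j - x z 0 i j)" if "i < p - r" "j < a"
    using that by blast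
  \<comment> \<open>For \<open>a \<le> j\<close> the parameter is read from column
    \<open>r + (j - a)\<close>, where the partial identity puts a \<open>1\<close> in row
    \<open>j\<close> of \<open>R\<close>.\<close>
  show "ord_ge 2 (\<lambda>z. P z (r + i) (r + (j - a)) - x z 0 i j)" if "i < p - r" "a \<le> j" "j < r"
    unfolding P_bottom
  proof (intro ord_ge_sum_mult x0)
    show "ord_ge 1 (\<lambda>z. R z l (r + (j - a)) - (if l = j then 1 else 0))" if "l < r" for l
      using x1[of l "j - a"] \<open>a \<le> j\<close> unfolding R_right by simp
  qed (use that in simp)
  show "P z i (r + j) = x z 1 i j" if "i < r"
    unfolding P_top[OF that] R_right ..
  \<comment> \<open>To first order row \<open>a + i\<close> contains \<open>x 2 - x 0\<close>;
    adding row \<open>r + i\<close>, which contains \<open>x 0\<close>, isolates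
    \<open>x 2\<close>.\<close>
  show "ord_ge 2 (\<lambda>z. P z (a + i) j + P z (r + i) j - x z 2 i j)" if "i < r - a" "j < a"
  proof -
    have "ord_ge 2 (\<lambda>z. (R z (a + i) j - E z (a + i) j + x z 0 (a + i - a) j) +
        (E z (a + i) j - x z 2 (a + i - a) j) + (P z (r + i) j - x z 0 i j))"
      using that a by (intro ord_ge_add Rbottom E2 J0) auto
    moreover have "P z (a + i) j = R z (a + i) j" for z using that by (intro P_top) auto
    ultimately show ?thesis by (simp add: algebra_simps)
  qed
  show "ord_ge 2 (\<lambda>z. P z i (a + j) - x z 3 i j)" if "i < a" "j < r - a"
  proof -
    have "R' z i (a + j) = x z 3 i j" for z unfolding R'_def inner_right_def right_factor_def by simp
    then show ?thesis using Rtop[of i "a + j"] that a by (simp add: P_top E_top)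
  qed
  show "ord_ge 1 (\<lambda>z. W z i j - (if i = j then 1 else 0))" if "i < a" "j < a"
  proof -
    have R0: "ord_ge 0 (\<lambda>z. R z l j)" if "l < r" for l
    proof -
      have "ord_ge 0 (\<lambda>z. (R z l j - (if l = j \<and> j < a then 1 else 0)) + (if l = j \<and> j < a then 1 else 0))"
        using that a \<open>j < a\<close> by (intro ord_ge_add ord_ge_const ord_ge_weaken[OF R1, of _ _ 0]) auto
      then show ?thesis by simp
    qed
    have "W z i j = (\<Sum>l<r. (R' z i l - (if i = l then 1 else 0)) * R z l j) + R z i j" for z
      using id_sum[of i r "\<lambda>l. R z l j"] that a
      unfolding W_def chart_right_def R'_def R_def by (simp add: left_diff_distrib sum_subtractf)
    then have e: "W z i j - (if i = j then 1 else 0) =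
        (\<Sum>l<r. (R' z i l - (if i = l then 1 else 0)) * R z l j) +
        (R z i j - (if i = j \<and> j < a then 1 else 0))" for z
      using that by simp
    have "ord_ge 1 (\<lambda>z. (R' z i l - (if i = l then 1 else 0)) * R z l j)" if "l < r" for l
      using ord_ge_mult[OF R'1[OF \<open>i < a\<close>, of l] R0[OF that]] by simp
    then show ?thesis
      unfolding e using that a by (intro ord_ge_add ord_ge_sum R1) auto
  qed
qed

section \<open>The commutator variety\<close>

text \<open>The blocks \<open>t < 4\<close> of coordinates parametrize the upper left corner of the matrix, those with
  \<open>4 \<le> t < 8\<close> the lower right corner, and block \<open>8\<close> the upper right corner. The shift in block
  \<open>1\<close> moves the base point of the chart to the origin.\<close>

definition param :: "nat \<Rightarrow> nat \<Rightarrow> (nat \<times> nat \<times> nat \<Rightarrow> 'a :: field) \<Rightarrow> nat \<Rightarrow> nat \<Rightarrow> nat \<Rightarrow> 'a" where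
  "param a m z t i j = z (m + t, i, j) + (if t = 1 \<and> i = a + j then 1 else 0)"

definition chart_index :: "nat \<Rightarrow> nat \<Rightarrow> nat \<Rightarrow> nat \<Rightarrow> nat \<Rightarrow> nat \<Rightarrow> (nat \<times> nat \<times> nat) set" where
  "chart_index p r a q s b = (SIGMA t:{..<9}.
     {..<[p - r, r, r - a, a, q - s, s, s - b, b, a] ! t} \<times>
     {..<[r, p - r, a, r - a, s, q - s, b, s - b, b] ! t})"

text \<open>The corner is \<open>U * Y * W\<close> with \<open>Y\<close> free:
  \<open>P Q = Q = Q S\<close> places \<open>Q\<close> in the column space of
  \<open>P\<^sup>2\<close> and the row space of \<open>S\<^sup>2\<close>, which \<open>U\<close> and
  \<open>W\<close> span.\<close>

definition chart_corner where
  "chart_corner q r a \<tau> \<tau>' s b \<sigma> \<sigma>' z i j =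
     (\<Sum>l<b. (\<Sum>k<a. chart_left r a \<tau> \<tau>' (param a 0 z) i k * z (8, k, l)) * chart_right q s b \<sigma> \<sigma>' (param b 4 z) l j)"

definition chart where
  "chart p r a \<tau> \<tau>' q s b \<sigma> \<sigma>' z = four_block_mat
     (fmat p p (chart_block p r a \<tau> \<tau>' (param a 0 z))) (fmat p q (chart_corner q r a \<tau> \<tau>' s b \<sigma> \<sigma>' z))
     (0\<^sub>m q p) (fmat q q (chart_block q s b \<sigma> \<sigma>' (param b 4 z)))"

lemma finite_chart_index: "finite (chart_index p r a q s b)"
  unfolding chart_index_def by auto

lemma card_chart_index:
  "card (chart_index p r a q s b) =
     2 * (r * (p - r)) + 2 * (a * (r - a)) + 2 * (s * (q - s)) + 2 * (b * (s - b)) + a * b"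
  unfolding chart_index_def by (subst card_SigmaI) (auto simp: lessThan_nat_numeral lessThan_Suc numeral_eq_Suc)

lemma four_block_mat_cases:
  assumes "X \<in> carrier_mat (p + q) (p + q)"
  obtains P Q R S where "P \<in> carrier_mat p p" "Q \<in> carrier_mat p q" "R \<in> carrier_mat q p"
    "S \<in> carrier_mat q q" "X = four_block_mat P Q R S"
proof -
  obtain P Q R S where "split_block X p p = (P, Q, R, S)" by (metis prod_cases4)
  from split_block[OF this, of q q] assms that show ?thesis by auto
qed

text \<open>Parameters repacked into a single \<open>z\<close> agree with the original ones only for
  \<open>t < 4\<close>; beyond that \<open>z\<close> holds other blocks.\<close>

lemma chart_param_cong:
  assumes "\<And>t. t < 4 \<Longrightarrow> x t = y t"
  shows "chart_block p' r a \<tau> \<tau>' x = chart_block p' r a \<tau> \<tau>' y" "chart_left r a \<tau> \<tau>' x = chart_left r a \<tau> \<tau>' y"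
    "chart_right p' r a \<tau> \<tau>' x = chart_right p' r a \<tau> \<tau>' y"
proof -
  have e: "x 0 = y 0" "x 1 = y 1" "x 2 = y 2" "x 3 = y 3" by (rule assms; simp)+
  show "chart_block p' r a \<tau> \<tau>' x = chart_block p' r a \<tau> \<tau>' y" "chart_left r a \<tau> \<tau>' x = chart_left r a \<tau> \<tau>' y"
    "chart_right p' r a \<tau> \<tau>' x = chart_right p' r a \<tau> \<tau>' y"
    by (simp_all only: chart_block_def[abs_def] chart_left_def[abs_def] chart_right_def[abs_def] outer_right_def idempotent_block_def[abs_def] inner_right_def e)
qed

context
  fixes p q n :: nat and A :: "'a :: field_char_0 mat" and V :: "'a mat set"
  assumes n: "n = p + q"
    and A: "A = four_block_mat (1\<^sub>m p) (0\<^sub>m p q) (0\<^sub>m q p) (0\<^sub>m q q)"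
    and V: "V = {X \<in> carrier_mat n n. X * A - A * X = X ^\<^sub>m 2 - X ^\<^sub>m 3}"
begin

lemma mem_commutator_variety_iff:
  fixes P Q R S :: "'a mat"
  assumes "P \<in> carrier_mat p p" "Q \<in> carrier_mat p q" "R \<in> carrier_mat q p" "S \<in> carrier_mat q q"
  shows "four_block_mat P Q R S \<in> V \<longleftrightarrow>
    R = 0\<^sub>m q p \<and> P * P * P = P * P \<and> S * S * S = S * S \<and> P * Q = Q \<and> Q * S = Q"
proof -
  let ?X = "four_block_mat P Q R S"
  have c: "?X \<in> carrier_mat n n" using assms n by simp
  then have "?X ^\<^sub>m 2 = ?X * ?X" "?X ^\<^sub>m 3 = ?X * ?X * ?X" by (simp_all add: numeral_eq_Suc)
  then show ?thesis
    unfolding V using c commutator_equation_iff[OF assms A refl] by simp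
qed

lemma chart_in_commutator_variety:
  assumes r: "r \<le> p" "a \<le> r" "\<tau> permutes {..<p}" "\<tau>' permutes {..<r}"
    and s: "s \<le> q" "b \<le> s" "\<sigma> permutes {..<q}" "\<sigma>' permutes {..<s}"
  shows "chart p r a \<tau> \<tau>' q s b \<sigma> \<sigma>' z \<in> V"
proof -
  let ?x = "param a 0 z" and ?y = "param b 4 z"
  define P where "P = fmat p p (chart_block p r a \<tau> \<tau>' ?x)"
  define U where "U = fmat p a (chart_left r a \<tau> \<tau>' ?x)"
  define S where "S = fmat q q (chart_block q s b \<sigma> \<sigma>' ?y)"
  define W where "W = fmat b q (chart_right q s b \<sigma> \<sigma>' ?y)"
  define Y where "Y = fmat a b (\<lambda>k l. z (8, k, l))"
  define Q where "Q = fmat p q (chart_corner q r a \<tau> \<tau>' s b \<sigma> \<sigma>' z)"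
  have Q: "Q = U * Y * W"
    unfolding Q_def U_def Y_def W_def fmat_mult by (rule fmat_cong) (simp add: chart_corner_def)
  note rel = chart_relations[OF r P_def U_def refl] chart_relations[OF s S_def refl W_def]
  have "P * Q = P * U * Y * W"
    unfolding Q by (simp add: assoc_mult_mat_dim P_def U_def Y_def W_def)
  also have "\<dots> = Q" unfolding rel Q ..
  finally have "P * Q = Q" .
  moreover have "Q * S = U * Y * (W * S)"
    unfolding Q by (simp add: assoc_mult_mat_dim S_def U_def Y_def W_def)
  then have "Q * S = Q" unfolding rel Q .
  ultimately have "four_block_mat P Q (0\<^sub>m q p) S \<in> V"
    using rel by (subst mem_commutator_variety_iff) (auto simp: P_def Q_def S_def)
  then show ?thesis unfolding chart_def P_def Q_def S_def .
qed

text \<open>\<open>Q = P\<^sup>2 Q S\<^sup>2\<close>, and both squares factor through their charts,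
  so \<open>Y = W * (Q * U')\<close> fills the corner.\<close>

lemma commutator_variety_covered:
  assumes "X \<in> V"
  shows "\<exists>r a \<tau> \<tau>' s b \<sigma> \<sigma>' z. r \<le> p \<and> a \<le> r \<and> \<tau> permutes {..<p} \<and> \<tau>' permutes {..<r} \<and>
    s \<le> q \<and> b \<le> s \<and> \<sigma> permutes {..<q} \<and> \<sigma>' permutes {..<s} \<and>
    X = chart p r a \<tau> \<tau>' q s b \<sigma> \<sigma>' z"
proof -
  have "X \<in> carrier_mat (p + q) (p + q)" using assms V n by simp
  then obtain P Q R S where c: "P \<in> carrier_mat p p" "Q \<in> carrier_mat p q" "R \<in> carrier_mat q p"
    "S \<in> carrier_mat q q" and X: "X = four_block_mat P Q R S"
    by (rule four_block_mat_cases)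
  have R: "R = 0\<^sub>m q p" and PPP: "P * P * P = P * P" and SSS: "S * S * S = S * S"
    and PQ: "P * Q = Q" and QS: "Q * S = Q"
    using assms unfolding X mem_commutator_variety_iff[OF c] by auto
  obtain r a \<tau> \<tau>' x where r: "r \<le> p" "a \<le> r" "\<tau> permutes {..<p}" "\<tau>' permutes {..<r}"
    and P: "P = fmat p p (chart_block p r a \<tau> \<tau>' x)" using chart_cover[OF c(1) PPP] by blast
  obtain s b \<sigma> \<sigma>' y where s: "s \<le> q" "b \<le> s" "\<sigma> permutes {..<q}" "\<sigma>' permutes {..<s}"
    and S: "S = fmat q q (chart_block q s b \<sigma> \<sigma>' y)" using chart_cover[OF c(4) SSS] by blast
  define U where "U = fmat p a (chart_left r a \<tau> \<tau>' x)"
  define W where "W = fmat a p (chart_right p r a \<tau> \<tau>' x)"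
  define U' where "U' = fmat q b (chart_left s b \<sigma> \<sigma>' y)"
  define W' where "W' = fmat b q (chart_right q s b \<sigma> \<sigma>' y)"
  define Y where "Y = W * (Q * U')"
  have Yc: "Y \<in> carrier_mat a b" 
    unfolding Y_def W_def U'_def by (rule mult_carrier_mat[OF fmat_carrier mult_carrier_mat[OF c(2) fmat_carrier]])
  have dims: "dim_row P = p" "dim_col P = p" "dim_row Q = p" "dim_col Q = q" "dim_row S = q" "dim_col S = q"
    "dim_row U = p" "dim_col U = a" "dim_row W = a" "dim_col W = p" "dim_row U' = q" "dim_col U' = b"
    "dim_row W' = b" "dim_col W' = q"
    using c unfolding U_def W_def U'_def W'_def by auto
  have "Q = P * P * Q" using PQ by (simp add: assoc_mult_mat_dim dims)
  also have "\<dots> = U * (W * Q)"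
    unfolding chart_relations(1)[OF r P U_def W_def] by (rule assoc_mult_mat_dim) (simp_all add: dims)
  finally have Q1: "Q = U * (W * Q)" .
  have "Q = Q * (S * S)" using QS by (simp add: dims flip: assoc_mult_mat_dim)
  then have Q2: "Q = Q * (U' * W')"
    unfolding chart_relations(1)[OF s S U'_def W'_def] .
  have "Q = U * (W * (Q * (U' * W')))" using Q1 Q2 by simp
  also have "\<dots> = U * Y * W'" unfolding Y_def by (simp add: assoc_mult_mat_dim dims)
  finally have Q: "Q = U * Y * W'" .
  \<comment> \<open>Subtracting the base point undoes the shift in \<open>param\<close>; block
    \<open>5\<close> is block \<open>1\<close> of the lower right corner.\<close>
  define z where "z = (\<lambda>(t, i, j).
      if t < 4 then x t i j - (if t = 1 \<and> i = a + j then 1 else 0)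
      else if t < 8 then y (t - 4) i j - (if t = 5 \<and> i = b + j then 1 else 0)
      else Y $$ (i, j))"
  have x: "param a 0 z t = x t" if "t < 4" for t
    using that by (intro ext) (auto simp: param_def z_def)
  have y: "param b 4 z t = y t" if "t < 4" for t
    using that by (intro ext) (auto simp: param_def z_def)
  have z8: "z (8, i, j) = Y $$ (i, j)" for i j unfolding z_def by simp
  have "U * Y * W' = fmat p q (chart_corner q r a \<tau> \<tau>' s b \<sigma> \<sigma>' z)"
    unfolding U_def W'_def
    by (subst fmat_entries[OF Yc, symmetric], unfold fmat_mult, rule fmat_cong)
      (simp add: chart_corner_def z8 chart_param_cong[OF x] chart_param_cong[OF y])
  then have "X = chart p r a \<tau> \<tau>' q s b \<sigma> \<sigma>' z"
    unfolding X R Q chart_def unfolding P S by (simp add: chart_param_cong[OF x] chart_param_cong[OF y])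
  then show ?thesis using r s by blast
qed

lemma polyf_chart_entry:
  assumes r: "r \<le> p" "a \<le> r" "\<tau> permutes {..<p}" "\<tau>' permutes {..<r}"
    and s: "s \<le> q" "b \<le> s" "\<sigma> permutes {..<q}" "\<sigma>' permutes {..<s}"
    and f: "poly_fun n f"
  shows "polyf (chart_index p r a q s b) (\<lambda>z. f (chart p r a \<tau> \<tau>' q s b \<sigma> \<sigma>' z :: 'a mat))"
proof -
  let ?I = "chart_index p r a q s b"
  have param: "polyf ?I (\<lambda>z. param d m z t i j :: 'a)" if "(m + t, i, j) \<in> ?I" for d m t i j
    unfolding param_def by (intro polyf.add polyf.const polyf.coord that)
  have x: "polyf ?I (\<lambda>z. chart_block p r a \<tau> \<tau>' (param a 0 z) i j :: 'a)" if "i < p" "j < p" for i j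
    by (rule polyf_chart(1)[OF r]; (rule that | rule param, simp add: chart_index_def))
  have u: "polyf ?I (\<lambda>z. chart_left r a \<tau> \<tau>' (param a 0 z) i k :: 'a)" if "i < p" "k < a" for i k
    by (rule polyf_chart(2)[OF r]; (rule that | rule param, simp add: chart_index_def))
  have y: "polyf ?I (\<lambda>z. chart_block q s b \<sigma> \<sigma>' (param b 4 z) i j :: 'a)" if "i < q" "j < q" for i j
    by (rule polyf_chart(1)[OF s]; (rule that | rule param, simp add: chart_index_def))
  have w: "polyf ?I (\<lambda>z. chart_right q s b \<sigma> \<sigma>' (param b 4 z) k j :: 'a)" if "k < b" "j < q" for k j
    by (rule polyf_chart(3)[OF s]; (rule that | rule param, simp add: chart_index_def))
  have Q: "polyf ?I (\<lambda>z. chart_corner q r a \<tau> \<tau>' s b \<sigma> \<sigma>' z i j :: 'a)" if "i < p" "j < q" for i j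
    unfolding chart_corner_def using that
    by (intro polyf_sum polyf.mult u w polyf.coord) (auto simp: chart_index_def)
  have entry: "polyf ?I (\<lambda>z. chart p r a \<tau> \<tau>' q s b \<sigma> \<sigma>' z $$ (i, j) :: 'a)"
    if "i < n" "j < n" for i j
    using that x[of i j] y[of "i - p" "j - p"] Q[of i "j - p"] unfolding chart_def n
    by (cases "i < p"; cases "j < p") (auto intro: polyf.const)
  from f show ?thesis
    by (induction rule: poly_fun.induct) (auto intro: polyf.const polyf.add polyf.mult entry)
qed

text \<open>Ranks and row orders take finitely many values, so finitely many charts cover
  \<open>V\<close>, with parameters counted by \<open>card_chart_index\<close>.\<close>

lemma commutator_variety_dim_le:
  assumes "\<And>r a s b. a \<le> r \<Longrightarrow> r \<le> p \<Longrightarrow> b \<le> s \<Longrightarrow> s \<le> q \<Longrightarrow>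
    2 * (r * (p - r)) + 2 * (a * (r - a)) + 2 * (s * (q - s)) + 2 * (b * (s - b)) + a * b \<le> N"
  shows "variety_dim n V \<le> enat N"
proof -
  define K where "K m = {(r, a, \<tau>, \<tau>'). r \<le> m \<and> a \<le> r \<and> \<tau> permutes {..<m} \<and> \<tau>' permutes {..<r}}"
    for m :: nat
  have K: "finite (K m)" for m
  proof (rule finite_subset)
    show "K m \<subseteq> {..m} \<times> {..m} \<times> {\<tau>. \<tau> permutes {..<m}} \<times> (\<Union>r\<le>m. {\<tau>. \<tau> permutes {..<r}})"
      unfolding K_def by auto
    show "finite ({..m} \<times> {..m} \<times> {\<tau>. \<tau> permutes {..<m}} \<times> (\<Union>r\<le>m. {\<tau>. \<tau> permutes {..<r}}))"
      by (auto intro!: finite_permutations)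
  qed
  show ?thesis
  proof (rule variety_dim_le[where F = "K p \<times> K q"
        and \<phi> = "\<lambda>((r, a, \<tau>, \<tau>'), (s, b, \<sigma>, \<sigma>')) z. chart p r a \<tau> \<tau>' q s b \<sigma> \<sigma>' z"
        and I = "\<lambda>((r, a, \<tau>, \<tau>'), (s, b, \<sigma>, \<sigma>')). chart_index p r a q s b"])
    show "finite (K p \<times> K q)" using K by simp
    show "V \<subseteq> (\<Union>k\<in>K p \<times> K q.
        range ((\<lambda>((r, a, \<tau>, \<tau>'), (s, b, \<sigma>, \<sigma>')) z. chart p r a \<tau> \<tau>' q s b \<sigma> \<sigma>' z) k))"
    proof
      fix X assume "X \<in> V"
      from commutator_variety_covered[OF this] obtain r a \<tau> \<tau>' s b \<sigma> \<sigma>' z where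
        *: "r \<le> p \<and> a \<le> r \<and> \<tau> permutes {..<p} \<and> \<tau>' permutes {..<r} \<and>
          s \<le> q \<and> b \<le> s \<and> \<sigma> permutes {..<q} \<and> \<sigma>' permutes {..<s}"
        and X: "X = chart p r a \<tau> \<tau>' q s b \<sigma> \<sigma>' z" by blast
      show "X \<in> (\<Union>k\<in>K p \<times> K q.
        range ((\<lambda>((r, a, \<tau>, \<tau>'), (s, b, \<sigma>, \<sigma>')) z. chart p r a \<tau> \<tau>' q s b \<sigma> \<sigma>' z) k))"
        by (rule UN_I[of "((r, a, \<tau>, \<tau>'), (s, b, \<sigma>, \<sigma>'))"]) (use * X in \<open>auto simp: K_def\<close>)
    qed
  qed (auto simp: K_def finite_chart_index card_chart_index intro!: polyf_chart_entry assms)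
qed

text \<open>The chart with identity permutations is used. \<open>chart_jet\<close> supplies
  functions of the matrix entries that invert it to first order at the base point; the bounds on
  \<open>r - a\<close> and \<open>s - b\<close> make room for the partial identities there.\<close>

lemma commutator_variety_dim_ge:
  assumes r: "a \<le> r" "r \<le> p" "r - a \<le> p - r" and s: "b \<le> s" "s \<le> q" "s - b \<le> q - s"
  shows "enat (2 * (r * (p - r)) + 2 * (a * (r - a)) + 2 * (s * (q - s)) + 2 * (b * (s - b)) + a * b)
    \<le> variety_dim n V"
proof -
  define \<phi> :: "(nat \<times> nat \<times> nat \<Rightarrow> 'a) \<Rightarrow> 'a mat" where
    "\<phi> = chart p r a id id q s b id id"
  let ?I = "chart_index p r a q s b"
  \<comment> \<open>These are the readouts of \<open>chart_jet\<close> for the corner starting at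
    offset \<open>m\<close>; in block \<open>1\<close> the base point is subtracted.\<close>
  define \<psi>' :: "nat \<Rightarrow> nat \<Rightarrow> nat \<Rightarrow> nat \<Rightarrow> nat \<Rightarrow> nat \<Rightarrow> 'a mat \<Rightarrow> 'a" where "\<psi>' m r a t i j X =
     (if t = 0 then if j < a then X $$ (m + (r + i), m + j) else X $$ (m + (r + i), m + (r + (j - a)))
      else if t = 1 then X $$ (m + i, m + (r + j)) - (if i = a + j then 1 else 0)
      else if t = 2 then X $$ (m + (a + i), m + j) + X $$ (m + (r + i), m + j)
      else X $$ (m + i, m + (a + j)))" for m r a t i j X
  define \<psi> :: "nat \<times> nat \<times> nat \<Rightarrow> 'a mat \<Rightarrow> 'a" where
    "\<psi> = (\<lambda>(t, i, j) X. if t < 4 then \<psi>' 0 r a t i j X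
      else if t < 8 then \<psi>' p s b (t - 4) i j X else X $$ (i, p + j))"
  have perm: "id permutes S" for S :: "nat set" by (rule permutes_id)
  have cases: "(\<exists>i j. k = (0, i, j) \<and> i < p - r \<and> j < r) \<or> (\<exists>i j. k = (1, i, j) \<and> i < r \<and> j < p - r) \<or>
      (\<exists>i j. k = (2, i, j) \<and> i < r - a \<and> j < a) \<or> (\<exists>i j. k = (3, i, j) \<and> i < a \<and> j < r - a) \<or>
      (\<exists>i j. k = (4, i, j) \<and> i < q - s \<and> j < s) \<or> (\<exists>i j. k = (5, i, j) \<and> i < s \<and> j < q - s) \<or>
      (\<exists>i j. k = (6, i, j) \<and> i < s - b \<and> j < b) \<or> (\<exists>i j. k = (7, i, j) \<and> i < b \<and> j < s - b) \<or>
      (\<exists>i j. k = (8, i, j) \<and> i < a \<and> j < b)" if "k \<in> ?I" for k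
  proof -
    obtain t i j where k: "k = (t, i, j)" by (metis prod_cases3)
    then have "t < 9" using that unfolding chart_index_def by simp
    then have "t = 0 \<or> t = 1 \<or> t = 2 \<or> t = 3 \<or> t = 4 \<or> t = 5 \<or> t = 6 \<or> t = 7 \<or> t = 8"
      by linarith
    then show ?thesis using that unfolding k chart_index_def by (elim disjE) simp_all
  qed
  have poly_fun_if: "poly_fun m (\<lambda>X. if c then f X else g X)"
    if "c \<Longrightarrow> poly_fun m f" "\<not> c \<Longrightarrow> poly_fun m g" for m c and f g :: "'a mat \<Rightarrow> 'a"
    using that by (cases c) auto
  have poly\<psi>: "poly_fun n (\<psi> k)" if "k \<in> ?I" for k
    using cases[OF that] r s unfolding \<psi>_def \<psi>'_def n
    by (elim disjE exE conjE) (auto intro!: poly_fun_if poly_fun_diff poly_fun.add poly_fun.const poly_fun.coord)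
  have c0: "ord_ge 1 (\<lambda>z. param d m z t i j - (if t = 1 \<and> i = d + j then 1 else 0) :: 'a)" for d m t i j
    unfolding param_def by (simp add: ord_ge_coord[unfolded One_nat_def])
  have c: "ord_ge 1 (\<lambda>z. param d m z 0 i j :: 'a)" "ord_ge 1 (\<lambda>z. param d m z 2 i j :: 'a)"
    "ord_ge 1 (\<lambda>z. param d m z 3 i j :: 'a)"
    "ord_ge 1 (\<lambda>z. param d m z 1 i j - (if i = d + j then 1 else 0) :: 'a)" for d m i j
    using c0[of d m 0 i j] c0[of d m 1 i j] c0[of d m 2 i j] c0[of d m 3 i j] by simp_all
  note jet_x = chart_jet[OF r(2,1,3), of "param a 0", OF c(1) c(4) c(2) c(3)]
  note jet_y = chart_jet[OF s(2,1,3), of "param b 4", OF c(1) c(4) c(2) c(3)]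
  have P: "\<phi> z $$ (i, j) = chart_block p r a id id (param a 0 z) i j" if "i < p" "j < p" for z i j
    using that unfolding \<phi>_def chart_def by simp
  have S: "\<phi> z $$ (p + i, p + j) = chart_block q s b id id (param b 4 z) i j" if "i < q" "j < q" for z i j
    using that unfolding \<phi>_def chart_def by simp
  have Q: "\<phi> z $$ (i, p + j) = (\<Sum>l<b. z (8, i, l) * chart_right q s b id id (param b 4 z) l j)"
    if "i < a" "j < b" for z i j
  proof -
    \<comment> \<open>The top \<open>a\<close> rows of \<open>U\<close> form the identity, so the
      top of the corner is \<open>Y * W\<close>, whose first \<open>b\<close> columns equal
      \<open>Y\<close> up to terms of order two.\<close>
    have U: "chart_left r a id id (param a 0 z) i k = (if i = k then 1 else 0)" if "k < a" for k
      unfolding chart_left_def left_factor_def using that \<open>i < a\<close> r(1) by (subst sum.remove[of _ i]) auto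
    have "(\<Sum>k<a. chart_left r a id id (param a 0 z) i k * z (8, k, l)) = z (8, i, l)" for l
      using that(1) by (subst sum.remove[of _ i]) (auto simp: U)
    then show ?thesis
      using that r s unfolding \<phi>_def chart_def by (simp add: chart_corner_def)
  qed
  have jet: "ord_ge 2 (\<lambda>z. \<psi> k (\<phi> z) - z k)" if "k \<in> ?I" for k
    using cases[OF that]
  proof (elim disjE exE conjE)
    fix i j assume k: "k = (0, i, j)" "i < p - r" "j < r"
    then show ?thesis using jet_x(1)[of i j] jet_x(2)[of i j] r
      by (cases "j < a") (simp_all add: \<psi>_def \<psi>'_def P param_def)
  next
    fix i j assume k: "k = (1, i, j)" "i < r" "j < p - r"
    then show ?thesis using jet_x(3)[of i _ j] r
      by (simp add: \<psi>_def \<psi>'_def P ord_ge_0) (simp add: param_def ord_ge_0)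
  next
    fix i j assume k: "k = (2, i, j)" "i < r - a" "j < a"
    then show ?thesis using jet_x(4)[of i j] r
      by (simp add: \<psi>_def \<psi>'_def P param_def numeral_2_eq_2)
  next
    fix i j assume k: "k = (3, i, j)" "i < a" "j < r - a"
    then show ?thesis using jet_x(5)[of i j] r by (simp add: \<psi>_def \<psi>'_def P param_def)
  next
    fix i j assume k: "k = (4, i, j)" "i < q - s" "j < s"
    moreover have "\<phi> z $$ (p + (s + i), p + (s + (j - b))) =
        chart_block q s b id id (param b 4 z) (s + i) (s + (j - b))" for z
      using k s by (intro S) auto
    ultimately show ?thesis using jet_y(1)[of i j] jet_y(2)[of i j] s
      by (cases "j < b") (simp_all add: \<psi>_def \<psi>'_def S param_def)
  next
    fix i j assume k: "k = (5, i, j)" "i < s" "j < q - s"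
    then show ?thesis using jet_y(3)[of i _ j] s
      by (simp add: \<psi>_def \<psi>'_def S ord_ge_0) (simp add: param_def ord_ge_0)
  next
    fix i j assume k: "k = (6, i, j)" "i < s - b" "j < b"
    then show ?thesis using jet_y(4)[of i j] s by (simp add: \<psi>_def \<psi>'_def S param_def)
  next
    fix i j assume k: "k = (7, i, j)" "i < b" "j < s - b"
    then show ?thesis using jet_y(5)[of i j] s by (simp add: \<psi>_def \<psi>'_def S param_def)
  next
    fix i j assume k: "k = (8, i, j)" "i < a" "j < b"
    have "ord_ge 2 (\<lambda>z. (\<Sum>l<b. z (8, i, l) * chart_right q s b id id (param b 4 z) l j) - z (8, i, j) :: 'a)"
      by (intro ord_ge_sum_mult ord_ge_coord jet_y(6) k)
    then show ?thesis using k by (simp add: \<psi>_def Q)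
  qed
  have closed: "zariski_closed n V"
    unfolding V by (rule zariski_closed_commutator_variety) (simp add: A n)
  have "enat (card ?I) \<le> variety_dim n V"
  proof (rule variety_dim_ge[where \<phi> = \<phi> and \<psi> = \<psi>, OF closed finite_chart_index])
    show "polyf ?I (\<lambda>z. f (\<phi> z))" if "poly_fun n f" for f
      unfolding \<phi>_def by (rule polyf_chart_entry[OF r(2,1) perm perm s(2,1) perm perm that])
    show "\<phi> z \<in> V" for z
      unfolding \<phi>_def by (rule chart_in_commutator_variety[OF r(2,1) perm perm s(2,1) perm perm])
    show "poly_fun n (\<psi> k)" if "k \<in> ?I" for k by (rule poly\<psi>[OF that])
    show "\<exists>h. \<forall>t. \<psi> k (\<phi> (\<lambda>j. t * x j)) = t * x k + t\<^sup>2 * poly h t" if "k \<in> ?I" for k x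
      using jet[OF that] unfolding ord_ge_def by (metis add.commute diff_eq_eq)
  qed
  then show ?thesis unfolding card_chart_index .
qed

end

section \<open>Optimizing the number of parameters over the integers\<close>

text \<open>Completing the square: with \<open>u = 8 a - 3 p - q\<close> and \<open>v = 8 b - 3 q - p\<close>, the number of
  parameters falls short of \<open>(11 p\<^sup>2 + 11 q\<^sup>2 + 2 p q) / 16\<close> by \<open>(3 u\<^sup>2 + 3 v\<^sup>2 - 2 u v) / 128\<close> plus
  half the squares of \<open>2 r - p - a\<close> and \<open>2 s - q - b\<close>.\<close>

lemma parameter_count_identity:
  fixes p q r a s b :: int
  shows "128 * (2 * (r * (p - r)) + 2 * (a * (r - a)) + 2 * (s * (q - s)) + 2 * (b * (s - b)) + a * b) =
    8 * (11 * p\<^sup>2 + 11 * q\<^sup>2 + 2 * p * q) - (((8*a - 3*p - q) - (8*b - 3*q - p))\<^sup>2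
      + 2 * (8*a - 3*p - q)\<^sup>2 + 2 * (8*b - 3*q - p)\<^sup>2) - 64 * ((2*r - p - a)\<^sup>2 + (2*s - q - b)\<^sup>2)"
  by (simp add: power2_eq_square algebra_simps)

lemma parameter_count_deficit:
  fixes p q r a s b :: nat
  assumes "a \<le> r" "r \<le> p" "b \<le> s" "s \<le> q"
  defines "\<alpha> \<equiv> 8 * int a - 3 * int p - int q" and "\<beta> \<equiv> 8 * int b - 3 * int q - int p"
  shows "128 * int (2 * (r * (p - r)) + 2 * (a * (r - a)) + 2 * (s * (q - s)) + 2 * (b * (s - b)) + a * b) =
    8 * int (11 * p\<^sup>2 + 11 * q\<^sup>2 + 2 * p * q) - ((\<alpha> - \<beta>)\<^sup>2 + 2 * \<alpha>\<^sup>2 + 2 * \<beta>\<^sup>2)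
    - 64 * ((2 * int r - int p - int a)\<^sup>2 + (2 * int s - int q - int b)\<^sup>2)"
proof -
  have "int (2 * (r * (p - r)) + 2 * (a * (r - a)) + 2 * (s * (q - s)) + 2 * (b * (s - b)) + a * b) =
    2 * (int r * (int p - int r)) + 2 * (int a * (int r - int a)) + 2 * (int s * (int q - int s)) +
    2 * (int b * (int s - int b)) + int a * int b"
    using assms(1-4) by (simp add: of_nat_diff)
  moreover have "int (11 * p\<^sup>2 + 11 * q\<^sup>2 + 2 * p * q) = 11 * (int p)\<^sup>2 + 11 * (int q)\<^sup>2 + 2 * int p * int q"
    by simp
  ultimately show ?thesis
    unfolding \<alpha>_def \<beta>_def by (simp only: parameter_count_identity)
qed

text \<open>The deficit is a nonnegative combination of squares, hence
  \<open>16 * N \<le> W\<close>, and integrality of \<open>N\<close> gives the floor.\<close>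

lemma parameter_count_le:
  fixes p q r a s b :: nat
  assumes "a \<le> r" "r \<le> p" "b \<le> s" "s \<le> q"
  shows "2 * (r * (p - r)) + 2 * (a * (r - a)) + 2 * (s * (q - s)) + 2 * (b * (s - b)) + a * b
    \<le> (11 * p\<^sup>2 + 11 * q\<^sup>2 + 2 * p * q) div 16" (is "?N \<le> _")
proof -
  define \<alpha> where "\<alpha> = 8 * int a - 3 * int p - int q"
  define \<beta> where "\<beta> = 8 * int b - 3 * int q - int p"
  define N where "N = ?N"
  define W where "W = 11 * p\<^sup>2 + 11 * q\<^sup>2 + 2 * p * q"
  define S where "S = (\<alpha> - \<beta>)\<^sup>2 + 2 * \<alpha>\<^sup>2 + 2 * \<beta>\<^sup>2"
  define T where "T = (2 * int r - int p - int a)\<^sup>2 + (2 * int s - int q - int b)\<^sup>2"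
  have "128 * int N = 8 * int W - S - 64 * T"
    unfolding N_def W_def S_def T_def \<alpha>_def \<beta>_def by (rule parameter_count_deficit[OF assms])
  moreover have "0 \<le> S" "0 \<le> T" unfolding S_def T_def by simp_all
  ultimately have "16 * N \<le> W" by linarith
  then have "N \<le> W div 16" by linarith
  then show ?thesis unfolding N_def W_def .
qed

text \<open>The real maximizer is rounded. In units of \<open>1 / 128\<close>, rounding
  \<open>a\<close> and \<open>b\<close> costs \<open>S < 128\<close>, and rounding \<open>r\<close>
  and \<open>s\<close> costs \<open>64 * T \<le> 128\<close>, in total less than
  \<open>2\<close>.\<close>

lemma parameter_count_ge:
  fixes p q :: nat
  assumes "q \<le> 5 * p" "p \<le> 5 * q"
  shows "\<exists>r a s b. a \<le> r \<and> r \<le> p \<and> r - a \<le> p - r \<and> b \<le> s \<and> s \<le> q \<and> s - b \<le> q - s \<and>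
    (11 * p\<^sup>2 + 11 * q\<^sup>2 + 2 * p * q) div 16 \<le>
      2 * (r * (p - r)) + 2 * (a * (r - a)) + 2 * (s * (q - s)) + 2 * (b * (s - b)) + a * b + 1"
proof -
  \<comment> \<open>Adding \<open>4\<close> before dividing rounds to the nearest integer and keeps
    \<open>8 * a\<close> within \<open>4\<close> of \<open>3 * p + q\<close>.\<close>
  define a where "a = (3 * p + q + 4) div 8"
  define b where "b = (3 * q + p + 4) div 8"
  define r where "r = (p + a) div 2"
  define s where "s = (q + b) div 2"
  \<comment> \<open>The bounds on the ratio enter here: \<open>3 * p + q \<le> 8 * p\<close> and
    \<open>3 * q + p \<le> 8 * q\<close> survive the rounding.\<close>
  have a: "a \<le> p" and b: "b \<le> q" unfolding a_def b_def using assms by linarith+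
  then have r: "a \<le> r" "r \<le> p" "r - a \<le> p - r" and s: "b \<le> s" "s \<le> q" "s - b \<le> q - s"
    unfolding r_def s_def by linarith+
  let ?N = "2 * (r * (p - r)) + 2 * (a * (r - a)) + 2 * (s * (q - s)) + 2 * (b * (s - b)) + a * b"
  define \<alpha> where "\<alpha> = 8 * int a - 3 * int p - int q"
  define \<beta> where "\<beta> = 8 * int b - 3 * int q - int p"
  define N where "N = ?N"
  define W where "W = 11 * p\<^sup>2 + 11 * q\<^sup>2 + 2 * p * q"
  define S where "S = (\<alpha> - \<beta>)\<^sup>2 + 2 * \<alpha>\<^sup>2 + 2 * \<beta>\<^sup>2"
  define T where "T = (2 * int r - int p - int a)\<^sup>2 + (2 * int s - int q - int b)\<^sup>2"
  have NW: "128 * int N = 8 * int W - S - 64 * T"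
    unfolding N_def W_def S_def T_def \<alpha>_def \<beta>_def by (rule parameter_count_deficit[OF r(1,2) s(1,2)])
  have \<alpha>: "-3 \<le> \<alpha>" "\<alpha> \<le> 4" and \<beta>: "-3 \<le> \<beta>" "\<beta> \<le> 4"
    unfolding \<alpha>_def \<beta>_def a_def b_def by linarith+
  have "\<alpha> \<in> {-3..4}" "\<beta> \<in> {-3..4}" using \<alpha> \<beta> by auto
  moreover have "{-3..4} = {-3, -2, -1, 0, 1, 2, 3, 4 :: int}" by auto
  ultimately have "S < 128" unfolding S_def by auto
  have "2 * int r - int p - int a \<in> {-1, 0}" "2 * int s - int q - int b \<in> {-1, 0}"
    unfolding r_def s_def by auto
  then have "T \<le> 2" unfolding T_def by auto
  with \<open>S < 128\<close> NW have "W < 16 * N + 32" by linarith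
  then have "W div 16 \<le> N + 1" by linarith
  then have "(11 * p\<^sup>2 + 11 * q\<^sup>2 + 2 * p * q) div 16 \<le> ?N + 1" unfolding W_def N_def .
  then show ?thesis using r s by blast
qed

theorem theorem2:
  fixes p q n \<rho> :: nat and A :: "'a :: {alg_closed_field, field_char_0} mat"
  assumes "p \<ge> 1" and "q \<ge> 1"
    and "1 / 5 \<le> real p / real q" and "real p / real q \<le> 5"
    and "n = p + q"
    and "A = diag_block_mat [1\<^sub>m p, 0\<^sub>m q q]"
    and "\<rho> = nat \<lfloor>(11 * real p ^ 2 + 11 * real q ^ 2 + 2 * real p * real q) / 16\<rfloor>"
  shows "variety_dim n {X \<in> carrier_mat n n. X * A - A * X = X ^\<^sub>m 2 - X ^\<^sub>m 3}
           \<in> {enat \<rho>, enat (\<rho> - 1)}"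
proof -
  let ?V = "{X \<in> carrier_mat n n. X * A - A * X = X ^\<^sub>m 2 - X ^\<^sub>m 3}"
  have A: "A = four_block_mat (1\<^sub>m p) (0\<^sub>m p q) (0\<^sub>m q p) (0\<^sub>m q q)"
    unfolding assms(6) diag_block_mat.simps(2)[of "1\<^sub>m p"] Let_def diag_block_mat_singleton by simp
  have "(11 * real p ^ 2 + 11 * real q ^ 2 + 2 * real p * real q) / 16 =
      real (11 * p\<^sup>2 + 11 * q\<^sup>2 + 2 * p * q) / real 16" by simp
  then have \<rho>: "\<rho> = (11 * p\<^sup>2 + 11 * q\<^sup>2 + 2 * p * q) div 16"
    unfolding assms(7) by (simp only: floor_divide_of_nat_eq nat_int)
  have "real q \<le> 5 * real p" "real p \<le> 5 * real q"
    using assms(2-4) by (simp_all add: field_simps)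
  then have pq: "q \<le> 5 * p" "p \<le> 5 * q" by linarith+
  have le: "variety_dim n ?V \<le> enat \<rho>"
    unfolding \<rho> by (rule commutator_variety_dim_le[OF assms(5) A refl]) (rule parameter_count_le)
  obtain r a s b where *: "a \<le> r" "r \<le> p" "r - a \<le> p - r" "b \<le> s" "s \<le> q" "s - b \<le> q - s"
    "\<rho> \<le> 2 * (r * (p - r)) + 2 * (a * (r - a)) + 2 * (s * (q - s)) + 2 * (b * (s - b)) + a * b + 1"
    using parameter_count_ge[OF pq] unfolding \<rho> by blast
  have "enat (\<rho> - 1) \<le>
      enat (2 * (r * (p - r)) + 2 * (a * (r - a)) + 2 * (s * (q - s)) + 2 * (b * (s - b)) + a * b)"
    using *(7) by simp
  also have "\<dots> \<le> variety_dim n ?V" by (rule commutator_variety_dim_ge[OF assms(5) A refl *(1-6)])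
  finally have ge: "enat (\<rho> - 1) \<le> variety_dim n ?V" .
  obtain d where d: "variety_dim n ?V = enat d" using le by (cases "variety_dim n ?V") auto
  then show ?thesis using le ge by auto
qed

end
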